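(* Let $L$ be a nonconstant entire function, $g$ an entire function and $f$ a nonconstant meromorphic function on $\mathbb{C}$, and let $n\geq2$, $m\geq3$ be integers with $(n,m)\neq(3,3)$. Then $f$ is a solution of $$f^n(z)+f^m(L(z))=e^{g(z)}$$ if and only if $L(z)=qz+c$ is a linear function (with constants $q,c$), $f(z)=Ae^{g(z)/n}$ and $$g(L(z))=\frac nm\,g(z)+n\,\mathrm{Ln}\frac BA,$$ where $A,B$ are two nonzero constants with $A^n+B^m=1$. In particular, if $m=n$ (and $f$ is a solution), then $|q|=1$.
   Context: Meromorphic and entire functions are on the whole complex plane $\mathbb{C}$; $f^n(z)$ means $(f(z))^n$. $\mathrm{Ln}\,w$ denotes the multivalued complex logarithm, i.e. $\mathrm{Ln}\frac BA$ stands for some complex number $\ell$ with $e^{\ell}=B/A$. *)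

theory Defs
  imports "HOL-Complex_Analysis.Complex_Analysis"
begin

(* A meromorphic function on the plane is represented by its total function in normal form
   (nicely_meromorphic_on UNIV): removable singularities are filled in and the value at a pole
   is the junk value 0.  An identity between meromorphic functions is therefore required exactly
   at the points where all functions involved are finite, i.e. where neither f(z) nor f(L(z))
   sits at a pole.  If L is nonconstant, the excluded points form a closed discrete set. *)
definition solves_fermat_eq ::
  "nat \<Rightarrow> nat \<Rightarrow> (complex \<Rightarrow> complex) \<Rightarrow> (complex \<Rightarrow> complex) \<Rightarrow> (complex \<Rightarrow> complex) \<Rightarrow> bool" where
  "solves_fermat_eq n m L g f \<longleftrightarrow>
     (\<forall>z. \<not> is_pole f z \<and> \<not> is_pole f (L z) \<longrightarrow> f z ^ n + f (L z) ^ m = exp (g z))"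

end

theory Submission
  imports Defs "HOL-Real_Asymp.Real_Asymp"
begin

text \<open>
  Put \<open>F = f exp (- g / n)\<close> and \<open>G = (f \<circ> L) exp (- g / m)\<close>. The equation becomes
  \<open>F ^ n + G ^ m = 1\<close>, and everything follows once \<open>F\<close> is known to be constant, that is
  \<open>f = A exp (g / n)\<close>.

  For \<open>n, m \<ge> 3\<close>, not both \<open>3\<close>, there are no nonconstant meromorphic \<open>F, G\<close> at all
  (\<open>fermat_meromorphic_constant\<close>), because the curve \<open>x ^ n + y ^ m = 1\<close> is hyperbolic. The proof
  makes the hyperbolicity explicit: write \<open>(x, y) = (X / D, Y / D)\<close> with entire functions and let
  \<open>\<omega>\<close> be the holomorphic differential with \<open>dx = m y ^ (m - 1) \<omega>\<close> and
  \<open>dy = - n x ^ (n - 1) \<omega>\<close>. For the right \<open>k \<ge> 1\<close> the density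
  \<open>(1 + |x|\<^sup>2 + |y|\<^sup>2) ^ k |\<omega>|\<^sup>2\<close> has no singularities at the poles, and its curvature is bounded
  above by a negative constant. By the Ahlfors-Schwarz comparison with the hyperbolic metrics of
  larger and larger discs no such density exists on the whole plane unless it vanishes
  (\<open>negative_curvature_imp_zero\<close>), so \<open>\<omega>\<close> pulls back to \<open>0\<close>.

  For \<open>n = 2\<close> this can fail, since \<open>x\<^sup>2 + y\<^sup>3 = 1\<close> and \<open>x\<^sup>2 + y\<^sup>4 = 1\<close> are elliptic and have
  nonconstant meromorphic parametrisations. Here the shape of \<open>G\<close> is used: if \<open>z\<close> is a pole of
  \<open>f\<close> then so is \<open>L z\<close>, of strictly smaller order because \<open>n < m\<close>, so \<open>f\<close> has no poles
  (\<open>no_poles_if_exponent_smaller\<close>). For entire \<open>F, G\<close> the factors of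
  \<open>(F - 1) (F + 1) = - G ^ m\<close> are \<open>m\<close>-th powers up to sign, and Picard's theorem ends this case
  (\<open>fermat_2_entire_constant\<close>).

  With \<open>f = A exp (g / n)\<close> the equation says that \<open>f \<circ> L = B exp (g / m)\<close>, whence
  \<open>g \<circ> L = (n / m) g + n l\<close>. Such an \<open>L\<close> is affine (\<open>affine_if_semiconjugate_to_affine\<close>):
  otherwise, by Schottky's theorem, \<open>L\<close> maps arbitrarily large discs of radius \<open>r\<close> over circles of
  radius at least \<open>K r\<close>, so \<open>g\<close> would grow too slowly from radius \<open>r\<close> to radius \<open>K r\<close>. If
  \<open>m = n\<close>, then \<open>g\<close> is invariant under \<open>z \<mapsto> q z + c\<close> up to a constant, and iterating towards the fixed
  point excludes \<open>|q| \<noteq> 1\<close>.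
\<close>

section \<open>A Liouville theorem for metrics of negative curvature\<close>

lemma second_derivative_nonpos_at_local_max:
  fixes \<phi> \<phi>' :: "real \<Rightarrow> real"
  assumes d1: "\<forall>\<^sub>F s in nhds 0. (\<phi> has_real_derivative \<phi>' s) (at s)"
    and d2: "(\<phi>' has_real_derivative D) (at 0)"
    and max: "\<forall>\<^sub>F s in nhds 0. \<phi> s \<le> \<phi> 0"
  shows "D \<le> 0"
proof (rule ccontr)
  assume "\<not> D \<le> 0"
  hence "D > 0" by simp
  from d1 max have "\<forall>\<^sub>F s in nhds 0. (\<phi> has_real_derivative \<phi>' s) (at s) \<and> \<phi> s \<le> \<phi> 0"
    by eventually_elim auto
  then obtain e where e: "e > 0"
    "\<And>s. dist s 0 < e \<Longrightarrow> (\<phi> has_real_derivative \<phi>' s) (at s) \<and> \<phi> s \<le> \<phi> 0"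
    unfolding eventually_nhds_metric by blast
  have "\<phi>' 0 = 0"
    by (rule DERIV_local_max[of \<phi> _ 0 e]) (use e in \<open>auto simp: dist_real_def\<close>)
  moreover obtain d where d: "d > 0" "\<And>h. 0 < h \<Longrightarrow> h < d \<Longrightarrow> \<phi>' 0 < \<phi>' (0 + h)"
    using DERIV_pos_inc_right[OF d2 \<open>D > 0\<close>] by auto
  ultimately have pos: "\<phi>' h > 0" if "0 < h" "h < d" for h :: real
    using that by (metis add_0)
  define t where "t = min d e / 2"
  have t: "0 < t" "t < d" "t < e" using d e by (auto simp: t_def min_def)
  have "\<exists>z. z > 0 \<and> z < t \<and> \<phi> t - \<phi> 0 = (t - 0) * \<phi>' z"
    using t e by (intro MVT2) (auto simp: dist_real_def)
  then obtain z where z: "z > 0" "z < t" "\<phi> t - \<phi> 0 = t * \<phi>' z" by auto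
  have "t * \<phi>' z > 0" using z t pos[of z] by simp
  moreover have "\<phi> t \<le> \<phi> 0" using e t by (auto simp: dist_real_def)
  ultimately show False using z by linarith
qed

lemma has_real_derivative_Re_along_line:
  assumes "(F has_field_derivative F') (at (z + of_real s * e))"
  shows "((\<lambda>s. Re (F (z + of_real s * e))) has_real_derivative Re (e * F')) (at s)"
proof -
  have "((\<lambda>s. z + of_real s * e) has_vector_derivative e) (at s)"
    by (auto intro!: derivative_eq_intros has_vector_derivative_real_field)
  from field_vector_diff_chain_at[OF this assms]
  have "((\<lambda>s. F (z + of_real s * e)) has_vector_derivative (e * F')) (at s)"
    by (simp add: o_def)
  from bounded_linear.has_vector_derivative[OF bounded_linear_Re this]
  show ?thesis
    by (simp add: has_real_derivative_iff_has_vector_derivative)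
qed

lemma second_derivative_ln:
  fixes N N' :: "real \<Rightarrow> real"
  assumes "\<And>s. (N has_real_derivative N' s) (at s)" "(N' has_real_derivative N'') (at 0)" "N 0 > 0"
  shows "\<forall>\<^sub>F s in nhds 0. ((\<lambda>s. ln (N s)) has_real_derivative N' s / N s) (at s)"
    and "((\<lambda>s. N' s / N s) has_real_derivative (N'' / N 0 - (N' 0 / N 0)\<^sup>2)) (at 0)"
    and "\<forall>\<^sub>F s in nhds 0. N s > 0"
proof -
  have "isCont N 0" using assms(1) DERIV_isCont by blast
  hence "(N \<longlongrightarrow> N 0) (nhds 0)" by (simp add: continuous_at tendsto_at_iff_tendsto_nhds)
  thus pos: "\<forall>\<^sub>F s in nhds 0. N s > 0" using assms(3) order_tendstoD by blast
  from pos show "\<forall>\<^sub>F s in nhds 0. ((\<lambda>s. ln (N s)) has_real_derivative N' s / N s) (at s)"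
    by eventually_elim (auto intro!: derivative_eq_intros assms(1))
  show "((\<lambda>s. N' s / N s) has_real_derivative (N'' / N 0 - (N' 0 / N 0)\<^sup>2)) (at 0)"
    using assms by (auto intro!: derivative_eq_intros simp: field_simps power2_eq_square)
qed


text \<open>
  The first two derivatives of \<open>|X|\<^sup>2\<close> along the line through \<open>z\<close> in direction \<open>e\<close>. In the sum over
  \<open>e = 1\<close> and \<open>e = \<i>\<close> the term with \<open>e\<^sup>2\<close> cancels.
\<close>
lemma norm_square_along_line:
  assumes X: "X holomorphic_on UNIV"
  defines "N \<equiv> \<lambda>z e s. (cmod (X (z + of_real s * e)))\<^sup>2"
      and "N' \<equiv> \<lambda>z e s. 2 * Re (e * (cnj (X (z + of_real s * e)) * deriv X (z + of_real s * e)))"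
  shows "(N z e has_real_derivative N' z e s) (at s)"
    and "(N' z e has_real_derivative
           2 * ((cmod e)\<^sup>2 * (cmod (deriv X z))\<^sup>2 + Re (e\<^sup>2 * (cnj (X z) * deriv (deriv X) z)))) (at 0)"
proof -
  have dX: "(X has_field_derivative deriv X w) (at w)" for w
    using X by (auto intro: holomorphic_derivI)
  have dX': "(deriv X has_field_derivative deriv (deriv X) w) (at w)" for w
    by (rule holomorphic_derivI[OF holomorphic_deriv[OF X]]) auto
  have im: "Im w = Re (-\<i> * w)" for w by simp
  have d1: "((\<lambda>s. Re (X (z + of_real s * e))) has_real_derivative Re (e * deriv X (z + of_real s * e))) (at s)" for s
    by (rule has_real_derivative_Re_along_line[OF dX])
  have d2: "((\<lambda>s. Im (X (z + of_real s * e))) has_real_derivative Im (e * deriv X (z + of_real s * e))) (at s)" for s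
    using has_real_derivative_Re_along_line[where F = "\<lambda>w. -\<i> * X w" and z=z and s=s and e=e,
        OF DERIV_cmult[OF dX]] by (simp add: add.commute)
  have d3: "((\<lambda>s. Re (e * deriv X (z + of_real s * e))) has_real_derivative
              Re (e * (e * deriv (deriv X) (z + of_real s * e)))) (at s)" for s
    using has_real_derivative_Re_along_line[where F = "\<lambda>w. e * deriv X w" and z=z and s=s and e=e,
        OF DERIV_cmult[OF dX']] by (simp add: mult_ac)
  have d4: "((\<lambda>s. Im (e * deriv X (z + of_real s * e))) has_real_derivative
              Im (e * (e * deriv (deriv X) (z + of_real s * e)))) (at s)" for s
    using has_real_derivative_Re_along_line[where F = "\<lambda>w. -\<i> * (e * deriv X w)" and z=z and s=s and e=e,
        OF DERIV_cmult[OF DERIV_cmult[OF dX']]] by (simp add: algebra_simps)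
  have eqN: "N z e = (\<lambda>s. (Re (X (z + of_real s * e)))\<^sup>2 + (Im (X (z + of_real s * e)))\<^sup>2)"
    unfolding N_def by (simp add: cmod_power2)
  have eqN': "N' z e = (\<lambda>s. 2 * (Re (X (z + of_real s * e)) * Re (e * deriv X (z + of_real s * e))
      + Im (X (z + of_real s * e)) * Im (e * deriv X (z + of_real s * e))))"
    unfolding N'_def by (intro ext) (simp add: algebra_simps)
  show "(N z e has_real_derivative N' z e s) (at s)"
    unfolding eqN eqN' power2_eq_square
    using DERIV_add[OF DERIV_mult[OF d1 d1] DERIV_mult[OF d2 d2]]
    by (rule DERIV_cong) simp
  show "(N' z e has_real_derivative
           2 * ((cmod e)\<^sup>2 * (cmod (deriv X z))\<^sup>2 + Re (e\<^sup>2 * (cnj (X z) * deriv (deriv X) z)))) (at 0)"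
    unfolding eqN'
    using DERIV_cmult[OF DERIV_add[OF DERIV_mult[OF d1[of 0] d3[of 0]] DERIV_mult[OF d2[of 0] d4[of 0]]], of 2]
    unfolding cmod_power2 by (rule DERIV_cong) (simp add: power2_eq_square algebra_simps)
qed

text \<open>
  The second derivative test for \<open>log (|\<Phi>|\<^sup>2 S ^ k (R\<^sup>2 - |z|\<^sup>2)\<^sup>2)\<close> at a local maximum, applied along the
  real and the imaginary direction. Adding the two gives the Laplacian: the summand \<open>log |\<Phi>|\<^sup>2\<close> is
  harmonic and drops out, \<open>k log S\<close> contributes the left-hand side by the Cauchy-Schwarz defect of
  \<open>X\<close> and its derivative, and \<open>log (R\<^sup>2 - |z|\<^sup>2)\<close> contributes the curvature of the Poincare metric of the
  disc of radius \<open>R\<close>.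
\<close>
lemma hyperbolic_comparison_at_local_max:
  fixes X :: "'i \<Rightarrow> complex \<Rightarrow> complex" and \<Phi> :: "complex \<Rightarrow> complex" and k :: nat and I :: "'i set"
  defines "S \<equiv> \<lambda>z. \<Sum>i\<in>I. (cmod (X i z))\<^sup>2"
  assumes X: "\<And>i. i \<in> I \<Longrightarrow> X i holomorphic_on UNIV"
    and \<Phi>: "\<Phi> holomorphic_on UNIV"
    and z0: "cmod z0 < R" "S z0 > 0" "\<Phi> z0 \<noteq> 0"
    and max: "\<forall>\<^sub>F z in nhds z0. (cmod (\<Phi> z))\<^sup>2 * S z ^ k * (R\<^sup>2 - (cmod z)\<^sup>2)\<^sup>2
                \<le> (cmod (\<Phi> z0))\<^sup>2 * S z0 ^ k * (R\<^sup>2 - (cmod z0)\<^sup>2)\<^sup>2"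
  shows "real k * (S z0 * (\<Sum>i\<in>I. (cmod (deriv (X i) z0))\<^sup>2)
            - (cmod (\<Sum>i\<in>I. cnj (X i z0) * deriv (X i) z0))\<^sup>2) / (S z0)\<^sup>2
         \<le> 2 * R\<^sup>2 / (R\<^sup>2 - (cmod z0)\<^sup>2)\<^sup>2"
proof -
  define P where "P = (\<Sum>i\<in>I. (cmod (deriv (X i) z0))\<^sup>2)"
  define A where "A = (\<Sum>i\<in>I. cnj (X i z0) * deriv (X i) z0)"
  define Q where "Q = (\<Sum>i\<in>I. cnj (X i z0) * deriv (deriv (X i)) z0)"
  define r where "r = R\<^sup>2 - (cmod z0)\<^sup>2"
  have r: "r > 0" using z0(1) by (simp add: r_def power_strict_mono)
  have "isCont \<Phi> z0" using \<Phi> holomorphic_on_imp_continuous_on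
    by (metis continuous_on_eq_continuous_at UNIV_I open_UNIV)
  then obtain \<delta> where \<delta>: "\<delta> > 0" "\<And>z. dist z0 z < \<delta> \<Longrightarrow> \<Phi> z \<noteq> 0"
    using continuous_at_avoid[of z0 \<Phi> 0] z0(3) by blast
  obtain l where l: "l holomorphic_on ball z0 \<delta>" "\<And>z. z \<in> ball z0 \<delta> \<Longrightarrow> \<Phi> z = exp (l z)"
  proof -
    have "contractible (ball z0 \<delta>)" by (simp add: convex_imp_contractible)
    from contractible_imp_holomorphic_log[OF holomorphic_on_subset[OF \<Phi>] this] \<delta>
    show ?thesis using that by (metis mem_ball subset_UNIV)
  qed
  have dl: "(l has_field_derivative deriv l w) (at w)" if "w \<in> ball z0 \<delta>" for w
    using l that by (auto intro: holomorphic_derivI)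
  have dl': "(deriv l has_field_derivative deriv (deriv l) z0) (at z0)"
    using l \<delta> by (intro holomorphic_derivI[OF holomorphic_deriv]) auto
  (* The second derivative at z0, in direction e, of the logarithm of the density in question. *)
  define D where "D = (\<lambda>e. real k * (2 * ((cmod e)\<^sup>2 * P + Re (e\<^sup>2 * Q)) / S z0 - (2 * Re (e * A) / S z0)\<^sup>2)
      + 2 * (- 2 * (cmod e)\<^sup>2 / r - (- (2 * Re (e * cnj z0)) / r)\<^sup>2) + 2 * Re (e\<^sup>2 * deriv (deriv l) z0))"
  have D_le: "D e \<le> 0" if e: "cmod e = 1" for e
  proof (rule second_derivative_nonpos_at_local_max)
    let ?p = "\<lambda>s. z0 + of_real s * e"
    define N' where "N' = (\<lambda>s. \<Sum>i\<in>I. 2 * Re (e * (cnj (X i (?p s)) * deriv (X i) (?p s))))"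
    define M where "M = (\<lambda>s::real. R\<^sup>2 - (cmod (?p s))\<^sup>2)"
    define M' where "M' = (\<lambda>s::real. - (2 * Re (e * cnj (?p s))))"
    define \<phi> where "\<phi> = (\<lambda>s. real k * ln (S (?p s)) + 2 * ln (M s) + 2 * Re (l (?p s)))"
    define \<phi>' where "\<phi>' = (\<lambda>s. real k * (N' s / S (?p s)) + 2 * (M' s / M s) + 2 * Re (e * deriv l (?p s)))"
    have S1: "((\<lambda>s. S (?p s)) has_real_derivative N' s) (at s)" for s
      unfolding S_def N'_def by (intro DERIV_sum norm_square_along_line X)
    have "(N' has_real_derivative (\<Sum>i\<in>I. 2 * ((cmod e)\<^sup>2 * (cmod (deriv (X i) z0))\<^sup>2
            + Re (e\<^sup>2 * (cnj (X i z0) * deriv (deriv (X i)) z0))))) (at 0)"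
      unfolding N'_def by (intro DERIV_sum norm_square_along_line X)
    also have "(\<Sum>i\<in>I. 2 * ((cmod e)\<^sup>2 * (cmod (deriv (X i) z0))\<^sup>2
            + Re (e\<^sup>2 * (cnj (X i z0) * deriv (deriv (X i)) z0)))) = 2 * ((cmod e)\<^sup>2 * P + Re (e\<^sup>2 * Q))"
      unfolding P_def Q_def by (simp only: sum_distrib_left sum.distrib Re_sum distrib_left)
    finally have S2: "(N' has_real_derivative 2 * ((cmod e)\<^sup>2 * P + Re (e\<^sup>2 * Q))) (at 0)" .
    have M1: "(M has_real_derivative M' s) (at s)" for s
      using DERIV_diff[OF DERIV_const[of "R\<^sup>2"] norm_square_along_line(1)[of "\<lambda>z. z" z0 e s]]
      unfolding M_def M'_def by simp
    have M2: "(M' has_real_derivative - 2 * (cmod e)\<^sup>2) (at 0)"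
    proof -
      have "M' = (\<lambda>s. - (2 * Re (e * cnj z0)) - 2 * (cmod e)\<^sup>2 * s)"
        unfolding M'_def cmod_power2 by (intro ext) (simp add: power2_eq_square algebra_simps)
      thus ?thesis by (auto intro!: derivative_eq_intros)
    qed
    have near: "\<forall>\<^sub>F s in nhds 0. P (?p s)" if "\<forall>\<^sub>F z in nhds z0. P z" for P
    proof -
      have "isCont ?p 0" by (intro continuous_intros)
      hence "(?p \<longlongrightarrow> z0) (nhds 0)"
        using tendsto_at_iff_tendsto_nhds[of ?p 0] by (simp add: isCont_def)
      with that show ?thesis by (rule eventually_compose_filterlim)
    qed
    have inball: "\<forall>\<^sub>F s in nhds 0. ?p s \<in> ball z0 \<delta>"
      using \<delta> by (intro near eventually_nhds_in_open) auto
    have N0: "S (?p 0) > 0" and M0: "M 0 > 0" using z0 r by (auto simp: M_def r_def)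
    note lnS = second_derivative_ln[OF S1 S2 N0]
    note lnM = second_derivative_ln[OF M1 M2 M0]
    show "\<forall>\<^sub>F s in nhds 0. (\<phi> has_real_derivative \<phi>' s) (at s)"
      using lnS(1) lnM(1) inball
    proof eventually_elim
      case (elim s)
      have "((\<lambda>s. Re (l (?p s))) has_real_derivative Re (e * deriv l (?p s))) (at s)"
        by (rule has_real_derivative_Re_along_line[OF dl[OF elim(3)]])
      with elim show ?case unfolding \<phi>_def \<phi>'_def
        by (intro DERIV_add DERIV_cmult)
    qed
    have "((\<lambda>s. Re (e * deriv l (?p s))) has_real_derivative Re (e * (e * deriv (deriv l) (?p 0)))) (at 0)"
      by (rule has_real_derivative_Re_along_line[where F="\<lambda>w. e * deriv l w"])
         (use dl' in \<open>auto intro!: derivative_eq_intros\<close>)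
    from DERIV_add[OF DERIV_add[OF DERIV_cmult[OF lnS(2), of "real k"] DERIV_cmult[OF lnM(2), of 2]] DERIV_cmult[OF this, of 2]]
    have "(\<phi>' has_real_derivative real k *
       (2 * ((cmod e)\<^sup>2 * P + Re (e\<^sup>2 * Q)) / S (?p 0) - (N' 0 / S (?p 0))\<^sup>2) +
        2 * (- 2 * (cmod e)\<^sup>2 / M 0 - (M' 0 / M 0)\<^sup>2) +
        2 * Re (e * (e * deriv (deriv l) (?p 0)))) (at 0)"
      unfolding \<phi>'_def .
    moreover have "N' 0 = 2 * Re (e * A)"
      unfolding N'_def A_def by (simp only: sum_distrib_left Re_sum of_real_0 mult_zero_left add_0_right)
    moreover have "M 0 = r" "M' 0 = - (2 * Re (e * cnj z0))" by (auto simp: M_def M'_def r_def)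
    ultimately show "(\<phi>' has_real_derivative D e) (at 0)"
      unfolding D_def by (simp only: of_real_0 mult_zero_left add_0_right power2_eq_square[of e] mult.assoc)
    note lnS(3) lnM(3)
    moreover note inball near[OF max]
    ultimately show "\<forall>\<^sub>F s in nhds 0. \<phi> s \<le> \<phi> 0"
    proof eventually_elim
      case (elim s)
      have phi: "exp (\<phi> s) = (cmod (\<Phi> (?p s)))\<^sup>2 * S (?p s) ^ k * (M s)\<^sup>2"
        if "S (?p s) > 0" "M s > 0" "?p s \<in> ball z0 \<delta>" for s
      proof -
        have "exp (\<phi> s) = exp (ln (S (?p s))) ^ k * exp (ln (M s)) ^ 2 * exp (Re (l (?p s))) ^ 2"
          unfolding \<phi>_def by (simp add: exp_add flip: exp_of_nat_mult)
        also have "exp (Re (l (?p s))) = cmod (\<Phi> (?p s))"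
          using l(2)[OF that(3)] by simp
        finally show ?thesis using that by (simp add: mult_ac)
      qed
      have "exp (\<phi> s) \<le> exp (\<phi> 0)"
        using elim N0 M0 \<delta> by (subst (1 2) phi) (auto simp: M_def)
      thus ?case by simp
    qed
  qed
  (* Harmonic terms and the terms in Q cancel between the two directions. *)
  have "D 1 + D \<i> \<le> 0" using D_le[of 1] D_le[of \<i>] by simp
  also have "D 1 + D \<i> = 4 * (real k * (P / S z0 - ((Re A)\<^sup>2 + (Im A)\<^sup>2) / (S z0)\<^sup>2))
       - 8 * (1 / r + ((Re z0)\<^sup>2 + (Im z0)\<^sup>2) / r\<^sup>2)"
    unfolding D_def by (simp add: power_divide power2_eq_square algebra_simps add_divide_distrib diff_divide_distrib)
  also have "1 / r + ((Re z0)\<^sup>2 + (Im z0)\<^sup>2) / r\<^sup>2 = (r + (cmod z0)\<^sup>2) / r\<^sup>2"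
    using r unfolding cmod_power2 by (simp add: field_simps power2_eq_square)
  also have "r + (cmod z0)\<^sup>2 = R\<^sup>2" by (simp add: r_def)
  also have "P / S z0 - ((Re A)\<^sup>2 + (Im A)\<^sup>2) / (S z0)\<^sup>2 = (S z0 * P - (cmod A)\<^sup>2) / (S z0)\<^sup>2"
    using z0(2) unfolding cmod_power2 by (simp add: field_simps power2_eq_square)
  finally show ?thesis
    unfolding P_def[symmetric] A_def[symmetric] r_def[symmetric] by simp
qed

text \<open>
  Ahlfors's lemma on the plane. The hypothesis says that the metric \<open>|\<Phi>|\<^sup>2 S ^ k |dz|\<^sup>2\<close> has curvature
  at most a negative constant wherever it does not vanish. On the disc of radius \<open>R\<close> the quotient of
  this metric by the Poincare metric vanishes on the boundary, so it has an interior maximum, where the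
  comparison of curvatures bounds it by a constant that depends only on \<open>k\<close> and \<open>c\<close>. As \<open>R\<close> grows, the
  Poincare metric at a fixed point tends to \<open>0\<close>.
\<close>
lemma negative_curvature_imp_zero:
  fixes X :: "'i \<Rightarrow> complex \<Rightarrow> complex" and \<Phi> :: "complex \<Rightarrow> complex" and k :: nat and I :: "'i set"
  defines "S \<equiv> \<lambda>z. \<Sum>i\<in>I. (cmod (X i z))\<^sup>2"
  assumes X: "\<And>i. i \<in> I \<Longrightarrow> X i holomorphic_on UNIV"
    and \<Phi>: "\<Phi> holomorphic_on UNIV" and k: "k > 0" and c: "c > 0"
    and curv: "\<And>z. c * ((cmod (\<Phi> z))\<^sup>2 * S z ^ (k + 2)) \<le> S z * (\<Sum>i\<in>I. (cmod (deriv (X i) z))\<^sup>2)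
            - (cmod (\<Sum>i\<in>I. cnj (X i z) * deriv (X i) z))\<^sup>2"
  shows "(cmod (\<Phi> z))\<^sup>2 * S z ^ k = 0"
proof -
  define lam where "lam = (\<lambda>z. (cmod (\<Phi> z))\<^sup>2 * S z ^ k)"
  have S_nonneg: "S z \<ge> 0" for z unfolding S_def by (intro sum_nonneg) auto
  hence lam_nonneg: "lam z \<ge> 0" for z by (simp add: lam_def)
  have cont: "continuous_on UNIV lam"
    unfolding lam_def S_def
    by (intro continuous_intros holomorphic_on_imp_continuous_on X \<Phi>)
  define C where "C = 2 / (real k * c)"
  have bound: "lam z * (R\<^sup>2 - (cmod z)\<^sup>2)\<^sup>2 \<le> C * R\<^sup>2" if R: "cmod z < R" for z R
  proof -
    define w where "w = (\<lambda>z. lam z * (R\<^sup>2 - (cmod z)\<^sup>2)\<^sup>2)"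
    have Rpos: "R > 0" using R norm_ge_zero order_le_less_trans by blast
    have "continuous_on (cball 0 R) w"
      unfolding w_def by (intro continuous_intros continuous_on_subset[OF cont]) auto
    then obtain z0 where z0: "z0 \<in> cball 0 R" "\<And>y. y \<in> cball 0 R \<Longrightarrow> w y \<le> w z0"
      using continuous_attains_sup[of "cball 0 R" w] Rpos by auto
    have wz: "w z \<le> w z0" using z0 R by auto
    have "w z0 \<le> C * R\<^sup>2"
    proof (cases "w z0 > 0")
      case False
      moreover have "C * R\<^sup>2 \<ge> 0" using k c by (simp add: C_def)
      ultimately show ?thesis by linarith
    next
      case True
      hence ne: "lam z0 \<noteq> 0" "R\<^sup>2 - (cmod z0)\<^sup>2 \<noteq> 0" by (auto simp: w_def)
      hence z0': "cmod z0 < R" using z0(1) by (cases "cmod z0 = R") auto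
      have \<Phi>0: "\<Phi> z0 \<noteq> 0" and "S z0 \<noteq> 0"
        using ne(1) k by (auto simp: lam_def)
      with S_nonneg[of z0] have S0: "S z0 > 0" by linarith
      have "\<forall>\<^sub>F y in nhds z0. y \<in> ball 0 R" using z0' by (intro eventually_nhds_in_open) auto
      hence "\<forall>\<^sub>F y in nhds z0. w y \<le> w z0" by eventually_elim (use z0 in auto)
      hence "\<forall>\<^sub>F y in nhds z0. (cmod (\<Phi> y))\<^sup>2 * S y ^ k * (R\<^sup>2 - (cmod y)\<^sup>2)\<^sup>2
                \<le> (cmod (\<Phi> z0))\<^sup>2 * S z0 ^ k * (R\<^sup>2 - (cmod z0)\<^sup>2)\<^sup>2"
        by (simp add: w_def lam_def)
      from hyperbolic_comparison_at_local_max[OF X \<Phi> z0' S0[unfolded S_def] \<Phi>0 this[unfolded S_def]]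
      have "real k * (S z0 * (\<Sum>i\<in>I. (cmod (deriv (X i) z0))\<^sup>2)
            - (cmod (\<Sum>i\<in>I. cnj (X i z0) * deriv (X i) z0))\<^sup>2) / (S z0)\<^sup>2
         \<le> 2 * R\<^sup>2 / (R\<^sup>2 - (cmod z0)\<^sup>2)\<^sup>2" by (simp add: S_def)
      moreover have "real k * (c * ((cmod (\<Phi> z0))\<^sup>2 * S z0 ^ (k + 2))) / (S z0)\<^sup>2 \<le>
         real k * (S z0 * (\<Sum>i\<in>I. (cmod (deriv (X i) z0))\<^sup>2)
            - (cmod (\<Sum>i\<in>I. cnj (X i z0) * deriv (X i) z0))\<^sup>2) / (S z0)\<^sup>2"
        using curv[of z0] by (intro divide_right_mono mult_left_mono) auto
      moreover have "real k * (c * ((cmod (\<Phi> z0))\<^sup>2 * S z0 ^ (k + 2))) / (S z0)\<^sup>2 = real k * c * lam z0"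
        using S0 by (simp add: lam_def power_add power2_eq_square)
      ultimately have "real k * c * lam z0 \<le> 2 * R\<^sup>2 / (R\<^sup>2 - (cmod z0)\<^sup>2)\<^sup>2"
        by linarith
      hence "real k * c * w z0 \<le> 2 * R\<^sup>2"
        using ne(2) by (simp add: w_def pos_le_divide_eq mult_ac)
      thus ?thesis using k c by (simp add: C_def field_simps)
    qed
    with wz show ?thesis by (simp add: w_def)
  qed
  have "lam z \<le> C * R\<^sup>2 / (R\<^sup>2 - (cmod z)\<^sup>2)\<^sup>2" if "cmod z < R" for R
  proof -
    have "(cmod z)\<^sup>2 < R\<^sup>2" using that by (simp add: power_strict_mono)
    thus ?thesis using bound[OF that] by (simp add: pos_le_divide_eq)
  qed
  hence "\<forall>\<^sub>F R in at_top. lam z \<le> C * R\<^sup>2 / (R\<^sup>2 - (cmod z)\<^sup>2)\<^sup>2"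
    by (rule eventually_mono[OF eventually_gt_at_top])
  moreover have "((\<lambda>R::real. C * R\<^sup>2 / (R\<^sup>2 - (cmod z)\<^sup>2)\<^sup>2) \<longlongrightarrow> 0) at_top"
    by real_asymp
  ultimately have "lam z \<le> 0"
    by (intro tendsto_lowerbound[of _ 0 at_top "lam z"]) auto
  with lam_nonneg[of z] show ?thesis by (simp add: lam_def)
qed

section \<open>Curvature of the Fermat curve\<close>

lemma power_sum3_le:
  fixes a b c :: real
  assumes "a \<ge> 0" "b \<ge> 0" "c \<ge> 0"
  shows "(a + b + c) ^ K \<le> 3 ^ K * (a ^ K + b ^ K + c ^ K)"
proof -
  define M where "M = max a (max b c)"
  have "(a + b + c) ^ K \<le> (3 * M) ^ K"
    using assms by (intro power_mono) (auto simp: M_def)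
  also have "\<dots> = 3 ^ K * M ^ K" by (rule power_mult_distrib)
  also have "M ^ K \<le> a ^ K + b ^ K + c ^ K"
    using assms zero_le_power[of a K] zero_le_power[of b K] zero_le_power[of c K]
    by (auto simp: M_def max_def)
  finally show ?thesis by simp
qed

text \<open>
  The right-hand side is the squared norm of the cross product of \<open>(1, x, y)\<close> with its derivative with
  respect to \<open>\<omega>\<close>, so this is the curvature estimate for the metric \<open>(1 + |x|\<^sup>2 + |y|\<^sup>2) ^ k |\<omega>|\<^sup>2\<close> with
  \<open>k = K - 2\<close>. If \<open>m = n\<close>, the last summand is the constant \<open>n\<^sup>2\<close> and the others control \<open>|x|\<close> and \<open>|y|\<close>. If
  \<open>m < n\<close>, the last summand grows like \<open>|x| ^ (2 n)\<close>, hence like \<open>|y| ^ (2 m)\<close>; it is small only where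
  \<open>x\<close> stays away from \<open>0\<close>, and there the second summand is bounded below.
\<close>
lemma fermat_curve_curvature_bound:
  fixes n m :: nat
  assumes mn: "m \<le> n" and m: "m \<ge> 3"
  defines "K \<equiv> (if m = n then m - 1 else m)"
  obtains c :: real where "c > 0"
    "\<And>x y :: complex. x ^ n + y ^ m = 1 \<Longrightarrow>
       c * (1 + (cmod x)\<^sup>2 + (cmod y)\<^sup>2) ^ K
       \<le> (cmod (of_nat m * y ^ (m - 1)))\<^sup>2 + (cmod (of_nat n * x ^ (n - 1)))\<^sup>2
          + (cmod (of_nat n * x ^ n + of_nat m * y ^ m))\<^sup>2"
proof (cases "m = n")
  case True
  show ?thesis
  proof (rule that[of "1 / 3 ^ (m - 1)"])
    fix x y :: complex assume xy: "x ^ n + y ^ m = 1"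
    have "(1 + (cmod x)\<^sup>2 + (cmod y)\<^sup>2) ^ (m - 1) \<le>
      3 ^ (m - 1) * (1 ^ (m - 1) + ((cmod x)\<^sup>2) ^ (m - 1) + ((cmod y)\<^sup>2) ^ (m - 1))"
      by (rule power_sum3_le) auto
    hence "1 / 3 ^ (m - 1) * (1 + (cmod x)\<^sup>2 + (cmod y)\<^sup>2) ^ (m - 1) \<le>
        1 + (cmod x ^ (m - 1))\<^sup>2 + (cmod y ^ (m - 1))\<^sup>2"
      by (simp add: divide_le_eq mult.commute flip: power_mult)
    also have "\<dots> \<le> (cmod (of_nat n * x ^ n + of_nat m * y ^ m))\<^sup>2
        + (cmod (of_nat n * x ^ (n - 1)))\<^sup>2 + (cmod (of_nat m * y ^ (m - 1)))\<^sup>2"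
    proof (intro add_mono)
      have "of_nat n * x ^ n + of_nat m * y ^ m = of_nat n * (x ^ n + y ^ m)"
        using True by (simp add: algebra_simps)
      thus "1 \<le> (cmod (of_nat n * x ^ n + of_nat m * y ^ m))\<^sup>2"
        using xy m True by (simp add: one_le_power)
      have "1 * cmod x ^ (m - 1) \<le> real n * cmod x ^ (n - 1)"
        unfolding True using m True by (intro mult_right_mono) auto
      thus "(cmod x ^ (m - 1))\<^sup>2 \<le> (cmod (of_nat n * x ^ (n - 1)))\<^sup>2"
        by (intro power_mono) (auto simp: norm_mult norm_power)
      have "1 * cmod y ^ (m - 1) \<le> real m * cmod y ^ (m - 1)"
        using m by (intro mult_right_mono) auto
      thus "(cmod y ^ (m - 1))\<^sup>2 \<le> (cmod (of_nat m * y ^ (m - 1)))\<^sup>2"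
        by (intro power_mono) (auto simp: norm_mult norm_power)
    qed
    finally show "1 / 3 ^ (m - 1) * (1 + (cmod x)\<^sup>2 + (cmod y)\<^sup>2) ^ K
       \<le> (cmod (of_nat m * y ^ (m - 1)))\<^sup>2 + (cmod (of_nat n * x ^ (n - 1)))\<^sup>2
          + (cmod (of_nat n * x ^ n + of_nat m * y ^ m))\<^sup>2"
      using True by (simp add: K_def)
  qed auto
next
  case False
  hence lt: "m < n" using mn by simp
  (* Chosen as 4 * (2 + 2 m^2 + 2 n^2) + 4: in the bound below 1 is replaced by 4 * num
     and |T|^2 by num. *)
  define B where "B = 12 + 8 * (real m)\<^sup>2 + 8 * (real n)\<^sup>2"
  have B: "B > 0" unfolding B_def by (intro add_pos_nonneg) auto
  show ?thesis
  proof (rule that[of "1 / (3 ^ m * B)"])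
    fix x y :: complex assume xy: "x ^ n + y ^ m = 1"
    define T where "T = of_nat n * x ^ n + of_nat m * y ^ m"
    define num where "num = (cmod (of_nat m * y ^ (m - 1)))\<^sup>2 + (cmod (of_nat n * x ^ (n - 1)))\<^sup>2 + (cmod T)\<^sup>2"
    define a b where "a = cmod x" and "b = cmod y"
    have Tx: "of_nat (n - m) * x ^ n = T - of_nat m"
      using xy lt unfolding T_def by (simp add: of_nat_diff algebra_simps flip: distrib_left)
    have Ty: "of_nat (n - m) * y ^ m = of_nat n - T"
      using xy lt unfolding T_def by (simp add: of_nat_diff algebra_simps flip: distrib_left)
    have d1: "real (n - m) \<ge> 1" using lt by simp
    have sq2: "u\<^sup>2 \<le> 2 * (v\<^sup>2 + w\<^sup>2)" if "0 \<le> u" "u \<le> v + w" for u v w :: real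
    proof -
      have "u\<^sup>2 \<le> (v + w)\<^sup>2" using that by (intro power_mono) auto
      also have "\<dots> \<le> 2 * (v\<^sup>2 + w\<^sup>2)" using zero_le_power2[of "v - w"] by (simp add: power2_eq_square algebra_simps)
      finally show ?thesis .
    qed
    have "a ^ n \<le> real (n - m) * a ^ n" using mult_right_mono[OF d1, of "a ^ n"] by (simp add: a_def)
    also have "\<dots> = cmod (T - of_nat m)" unfolding Tx[symmetric] a_def by (simp add: norm_mult norm_power)
    also have "\<dots> \<le> cmod T + real m" using norm_triangle_ineq4[of T "of_nat m"] by simp
    finally have an: "(a ^ n)\<^sup>2 \<le> 2 * ((cmod T)\<^sup>2 + (real m)\<^sup>2)" by (intro sq2) (auto simp: a_def)
    have "b ^ m \<le> real (n - m) * b ^ m" using mult_right_mono[OF d1, of "b ^ m"] by (simp add: b_def)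
    also have "\<dots> = cmod (of_nat n - T)" unfolding Ty[symmetric] b_def by (simp add: norm_mult norm_power)
    also have "\<dots> \<le> real n + cmod T" using norm_triangle_ineq4[of "of_nat n" T] by simp
    finally have bm: "(b ^ m)\<^sup>2 \<le> 2 * ((real n)\<^sup>2 + (cmod T)\<^sup>2)" by (intro sq2) (auto simp: b_def)
    have am: "(a ^ m)\<^sup>2 \<le> 1 + (a ^ n)\<^sup>2"
    proof (cases "a \<le> 1")
      case True
      hence "(a ^ m)\<^sup>2 \<le> 1" by (intro power_le_one) (auto simp: a_def)
      thus ?thesis using zero_le_power2[of "a ^ n"] by linarith
    next
      case False
      hence "(a ^ m)\<^sup>2 \<le> (a ^ n)\<^sup>2" using lt by (intro power_mono power_increasing) auto
      thus ?thesis by linarith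
    qed
    have numT: "num \<ge> (cmod T)\<^sup>2" and numx: "num \<ge> (real n * a ^ (n - 1))\<^sup>2"
      by (simp_all add: num_def a_def norm_mult norm_power)
    have num4: "4 * num \<ge> 1"
    proof (cases "cmod T \<ge> 1/2")
      case True
      hence "(cmod T)\<^sup>2 \<ge> (1/2)\<^sup>2" by (intro power_mono) auto
      with numT show ?thesis by (simp add: power2_eq_square)
    next
      case False
      have "real m - cmod T \<le> cmod (T - of_nat m)"
        using norm_triangle_ineq2[of "of_nat m" T] by (simp add: norm_minus_commute)
      also have "\<dots> = real (n - m) * a ^ n" unfolding Tx[symmetric] a_def by (simp add: norm_mult norm_power)
      also have "\<dots> \<le> real n * a ^ n" by (intro mult_right_mono) (auto simp: a_def)
      finally have "1 \<le> real n * a ^ n" using False m by linarith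
      moreover have "1 \<le> real n * a ^ (n - 1)"
      proof (cases "a \<le> 1")
        case True
        have "a ^ n \<le> a ^ (n - 1)" using True by (intro power_decreasing) (auto simp: a_def)
        thus ?thesis using \<open>1 \<le> real n * a ^ n\<close> mult_left_mono[of "a ^ n" "a ^ (n - 1)" "real n"] by linarith
      next
        case False
        hence "1 * 1 \<le> real n * a ^ (n - 1)" using lt m by (intro mult_mono one_le_power) auto
        thus ?thesis by simp
      qed
      hence "1 \<le> (real n * a ^ (n - 1))\<^sup>2" by (rule one_le_power)
      with numx show ?thesis by linarith
    qed
    have "1 + (a ^ m)\<^sup>2 + (b ^ m)\<^sup>2 \<le> (2 + 2 * (real m)\<^sup>2 + 2 * (real n)\<^sup>2) * 1 + 4 * (cmod T)\<^sup>2"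
      using am an bm by simp
    also have "\<dots> \<le> (2 + 2 * (real m)\<^sup>2 + 2 * (real n)\<^sup>2) * (4 * num) + 4 * num"
      using num4 numT by (intro add_mono mult_left_mono) auto
    also have "\<dots> = B * num" by (simp add: B_def algebra_simps)
    finally have le: "1 + (a ^ m)\<^sup>2 + (b ^ m)\<^sup>2 \<le> B * num" .
    have "(1 + a\<^sup>2 + b\<^sup>2) ^ m \<le> 3 ^ m * (1 ^ m + (a\<^sup>2) ^ m + (b\<^sup>2) ^ m)"
      by (rule power_sum3_le) auto
    also have "\<dots> = 3 ^ m * (1 + (a ^ m)\<^sup>2 + (b ^ m)\<^sup>2)" by (simp add: power_mult[symmetric] mult.commute)
    also have "\<dots> \<le> 3 ^ m * (B * num)" using le by (intro mult_left_mono) auto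
    finally have "1 / (3 ^ m * B) * (1 + a\<^sup>2 + b\<^sup>2) ^ m \<le> num"
      using B by (simp add: divide_le_eq mult_ac)
    thus "1 / (3 ^ m * B) * (1 + (cmod x)\<^sup>2 + (cmod y)\<^sup>2) ^ K
       \<le> (cmod (of_nat m * y ^ (m - 1)))\<^sup>2 + (cmod (of_nat n * x ^ (n - 1)))\<^sup>2
          + (cmod (of_nat n * x ^ n + of_nat m * y ^ m))\<^sup>2"
      using False by (simp add: K_def num_def T_def a_def b_def)
  qed (use B in auto)
qed

lemma entire_eventually_nonzero:
  assumes "Q holomorphic_on UNIV" "Q a \<noteq> 0"
  shows "\<forall>\<^sub>F w in at z. Q w \<noteq> 0"
  using non_zero_neighbour_alt[of Q UNIV z a] assms by auto

text \<open>
  The zeros of \<open>Q\<close> are isolated, so the points where the inequality is known are dense.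
\<close>
lemma le_everywhere_if_le_off_zeros:
  fixes u v :: "complex \<Rightarrow> real"
  assumes Q: "Q holomorphic_on UNIV" "Q a \<noteq> 0"
    and u: "continuous_on UNIV u" and v: "continuous_on UNIV v"
    and le: "\<And>z. Q z \<noteq> 0 \<Longrightarrow> u z \<le> v z"
  shows "u z \<le> v z"
proof (rule tendsto_le)
  show "(u \<longlongrightarrow> u z) (at z)" "(v \<longlongrightarrow> v z) (at z)"
    using u v by (auto simp: continuous_on_def)
  show "\<forall>\<^sub>F w in at z. u w \<le> v w"
    using entire_eventually_nonzero[OF Q] by eventually_elim (rule le)
qed auto

lemma eq_everywhere_if_eq_off_zeros:
  fixes u v :: "complex \<Rightarrow> complex"
  assumes Q: "Q holomorphic_on UNIV" "Q a \<noteq> 0"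
    and u: "continuous_on UNIV u" and v: "continuous_on UNIV v"
    and eq: "\<And>z. Q z \<noteq> 0 \<Longrightarrow> u z = v z"
  shows "u z = v z"
proof -
  have "cmod (u z - v z) \<le> 0"
    by (rule le_everywhere_if_le_off_zeros[OF Q]) (use u v eq in \<open>auto intro!: continuous_intros\<close>)
  thus ?thesis by simp
qed

text \<open>
  Riemann's removable singularity theorem for a quotient of entire functions.
\<close>
lemma entire_quotient_if_limits:
  assumes P: "P holomorphic_on UNIV" and Q: "Q holomorphic_on UNIV" "Q a \<noteq> 0"
    and lim: "\<And>z. Q z = 0 \<Longrightarrow> \<exists>c. (\<lambda>w. P w / Q w) \<midarrow>z\<rightarrow> c"
  obtains \<Phi> where "\<Phi> holomorphic_on UNIV" "\<And>z. P z = \<Phi> z * Q z"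
proof -
  define \<Phi> where "\<Phi> = remove_sings (\<lambda>w. P w / Q w)"
  have an: "P analytic_on A" "Q analytic_on A" for A
    using P Q(1) by (auto simp: analytic_on_holomorphic)
  have iso: "isolated_singularity_at (\<lambda>w. P w / Q w) z" for z
    using an by (intro meromorphic_on_isolated_singularity meromorphic_intros analytic_on_imp_meromorphic_on) auto
  have good: "\<Phi> analytic_on {z}" for z
  proof -
    have "\<exists>c. (\<lambda>w. P w / Q w) \<midarrow>z\<rightarrow> c"
    proof (cases "Q z = 0")
      case False
      thus ?thesis using an[of "{z}"]
        by (intro exI[of _ "P z / Q z"] tendsto_divide) (auto dest!: analytic_at_imp_isCont isContD)
    qed (rule lim)
    thus ?thesis unfolding \<Phi>_def using remove_sings_analytic_at[OF iso] by blast
  qed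
  have hol: "\<Phi> holomorphic_on UNIV"
    using good analytic_on_analytic_at analytic_imp_holomorphic by blast
  have eq: "P z = \<Phi> z * Q z" if "Q z \<noteq> 0" for z
  proof -
    have "\<Phi> z = P z / Q z" unfolding \<Phi>_def
      using an[of "{z}"] that by (intro remove_sings_at_analytic analytic_intros) auto
    thus ?thesis using that by simp
  qed
  have "P z = \<Phi> z * Q z" for z
    by (rule eq_everywhere_if_eq_off_zeros[OF Q, where u = P and v = "\<lambda>z. \<Phi> z * Q z"])
       (use P Q hol eq in \<open>auto intro!: holomorphic_on_imp_continuous_on holomorphic_intros\<close>)
  with hol show ?thesis by (rule that)
qed

text \<open>
  The logarithmic derivative of \<open>D\<close> has a simple pole at \<open>z\<close>, which the zero of \<open>X\<close> absorbs.
\<close>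
lemma tendsto_mult_logderiv_at_common_zero:
  assumes X: "X holomorphic_on UNIV" "X z = 0"
    and D: "D holomorphic_on UNIV" "D z = 0" "D a \<noteq> 0"
  shows "\<exists>c. (\<lambda>w. X w * deriv D w / D w) \<midarrow>z\<rightarrow> c"
proof -
  have nc: "\<not> D constant_on UNIV" using D unfolding constant_on_def by (metis UNIV_I)
  obtain g r p where p: "0 < p" "0 < r" "ball z r \<subseteq> UNIV" "g holomorphic_on ball z r"
     "\<And>w. w \<in> ball z r \<Longrightarrow> D w = (w - z) ^ p * g w" "\<And>w. w \<in> ball z r \<Longrightarrow> g w \<noteq> 0"
    by (rule holomorphic_factor_zero_nonconstant[OF D(1) open_UNIV connected_UNIV UNIV_I D(2) nc]) (rule that)
  have ev: "\<forall>\<^sub>F w in at z. w \<in> ball z r" using p(2) by (intro eventually_at_in_open') auto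
  have "\<forall>\<^sub>F w in at z. X w * deriv D w / D w
          = (X w - X z) / (w - z) * (of_nat p + (w - z) * (deriv g w / g w))"
    using ev eventually_neq_at_within[of z z]
  proof eventually_elim
    case (elim w)
    have "((\<lambda>w. (w - z) ^ p * g w) has_field_derivative
        (of_nat p * (w - z) ^ (p - 1) * g w + deriv g w * (w - z) ^ p)) (at w)"
      using holomorphic_derivI[OF p(4) open_ball elim(1)]
      by (auto intro!: derivative_eq_intros)
    hence "(D has_field_derivative
        (of_nat p * (w - z) ^ (p - 1) * g w + deriv g w * (w - z) ^ p)) (at w)"
      by (rule has_field_derivative_transform_within_open[OF _ open_ball elim(1)]) (use p(5) in auto)
    hence "deriv D w = of_nat p * (w - z) ^ (p - 1) * g w + deriv g w * (w - z) ^ p"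
      by (rule DERIV_imp_deriv)
    moreover have pE: "(w - z) ^ p = (w - z) * (w - z) ^ (p - 1)"
      using p(1) by (metis power_minus_mult mult.commute)
    moreover define u E where "u = w - z" and "E = (w - z) ^ (p - 1)"
    moreover have "u \<noteq> 0" "E \<noteq> 0" using elim(2) by (auto simp: u_def E_def)
    ultimately show ?case
      unfolding p(5)[OF elim(1)] X(2) pE u_def[symmetric] E_def[symmetric]
      using p(6)[OF elim(1)] by (simp add: field_simps)
  qed
  note ev2 = this
  have "(X has_field_derivative deriv X z) (at z)"
    using X by (auto intro: holomorphic_derivI)
  hence lim1: "(\<lambda>w. (X w - X z) / (w - z)) \<midarrow>z\<rightarrow> deriv X z" by (simp add: has_field_derivative_iff)
  have lim2: "isCont (\<lambda>w. of_nat p + (w - z) * (deriv g w / g w)) z"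
  proof -
    have "(\<lambda>w. of_nat p + (w - z) * (deriv g w / g w)) holomorphic_on ball z r"
      using p by (intro holomorphic_intros holomorphic_deriv) auto
    thus ?thesis using p(2) by (metis continuous_on_eq_continuous_at open_ball centre_in_ball holomorphic_on_imp_continuous_on)
  qed
  have "(\<lambda>w. X w * deriv D w / D w) \<midarrow>z\<rightarrow> deriv X z * (of_nat p + (z - z) * (deriv g z / g z))"
    unfolding tendsto_cong[OF ev2] by (intro tendsto_mult lim1 isContD[OF lim2])
  thus ?thesis by blast
qed

text \<open>
  It turns the Cauchy-Schwarz defect in the curvature into the squared norm of a cross product.
\<close>
lemma lagrange_identity_3:
  fixes a b c a' b' c' :: complex
  shows "((cmod a)\<^sup>2 + (cmod b)\<^sup>2 + (cmod c)\<^sup>2) * ((cmod a')\<^sup>2 + (cmod b')\<^sup>2 + (cmod c')\<^sup>2)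
       - (cmod (cnj a * a' + cnj b * b' + cnj c * c'))\<^sup>2
       = (cmod (a' * c - a * c'))\<^sup>2 + (cmod (b' * c - b * c'))\<^sup>2 + (cmod (a * b' - b * a'))\<^sup>2"
  unfolding cmod_power2 by (simp add: power2_eq_square) algebra

lemma proportional_if_wronskian_zero:
  assumes X: "X holomorphic_on UNIV" and D: "D holomorphic_on UNIV" "D z0 \<noteq> 0"
    and W: "\<And>z. deriv X z * D z - X z * deriv D z = 0"
  obtains a where "\<And>z. X z = a * D z"
proof -
  define a where "a = X z0 / D z0"
  have dX: "(X has_field_derivative deriv X z) (at z)" and dD: "(D has_field_derivative deriv D z) (at z)" for z
    using X D by (auto intro: holomorphic_derivI)
  have "isCont D z0" using dD DERIV_isCont by blast
  then obtain e where e: "e > 0" "\<And>z. dist z0 z < e \<Longrightarrow> D z \<noteq> 0"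
    using continuous_at_avoid[of z0 D 0] D by blast
  have loc: "X z = a * D z" if z: "z \<in> ball z0 e" for z
  proof -
    have "\<exists>c. \<forall>w\<in>ball z0 e. X w / D w = c"
    proof (rule has_field_derivative_zero_constant)
      fix w assume w: "w \<in> ball z0 e"
      show "((\<lambda>z. X z / D z) has_field_derivative 0) (at w within ball z0 e)"
        using DERIV_divide[OF dX dD, of w] W[of w] e(2)[of w] w
        by (auto intro: has_field_derivative_at_within simp: mult.commute)
    qed auto
    hence "X z / D z = X z0 / D z0" using z e(1) by auto
    thus ?thesis using e(2)[of z] z by (simp add: a_def field_simps)
  qed
  have "X z = a * D z" for z
    by (rule analytic_continuation_open[of "ball z0 e" UNIV X "\<lambda>z. a * D z"])
       (use e X D loc in \<open>auto intro!: holomorphic_intros\<close>)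
  thus ?thesis by (rule that)
qed

text \<open>
  This is the differential of \<open>x ^ n + y ^ m = 1\<close> with denominators cleared, for \<open>x = X / D\<close> and
  \<open>y = Y / D\<close>.
\<close>
lemma fermat_wronskian_relation:
  assumes hol: "X holomorphic_on UNIV" "Y holomorphic_on UNIV" "D holomorphic_on UNIV"
    and mn: "m \<le> n" "m \<ge> 1"
    and eq: "\<And>z. X z ^ n + Y z ^ m * D z ^ (n - m) = D z ^ n"
  shows "of_nat n * X z ^ (n - 1) * (deriv X z * D z - X z * deriv D z)
       + of_nat m * Y z ^ (m - 1) * D z ^ (n - m) * (deriv Y z * D z - Y z * deriv D z) = 0"
proof -
  have d: "(X has_field_derivative deriv X z) (at z)" "(Y has_field_derivative deriv Y z) (at z)"
     "(D has_field_derivative deriv D z) (at z)"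
    using hol by (auto intro: holomorphic_derivI)
  have pw: "((\<lambda>z. f z ^ j) has_field_derivative of_nat j * f z ^ (j - 1) * f') (at z)"
    if "(f has_field_derivative f') (at z)" for f :: "complex \<Rightarrow> complex" and f' j
    using DERIV_power[OF that, of j] by (simp add: mult_ac)
  have "((\<lambda>z. X z ^ n + Y z ^ m * D z ^ (n - m)) has_field_derivative
     of_nat n * X z ^ (n - 1) * deriv X z + (of_nat m * Y z ^ (m - 1) * deriv Y z * D z ^ (n - m)
       + of_nat (n - m) * D z ^ (n - m - 1) * deriv D z * Y z ^ m)) (at z)"
    by (intro DERIV_add DERIV_mult pw d)
  moreover have "((\<lambda>z. D z ^ n) has_field_derivative of_nat n * D z ^ (n - 1) * deriv D z) (at z)"
    by (intro pw d)
  ultimately have "of_nat n * X z ^ (n - 1) * deriv X z + (of_nat m * Y z ^ (m - 1) * deriv Y z * D z ^ (n - m)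
       + of_nat (n - m) * D z ^ (n - m - 1) * deriv D z * Y z ^ m) = of_nat n * D z ^ (n - 1) * deriv D z"
    unfolding eq by (rule DERIV_unique)
  hence "(of_nat n * X z ^ (n - 1) * deriv X z + (of_nat m * Y z ^ (m - 1) * deriv Y z * D z ^ (n - m)
       + of_nat (n - m) * D z ^ (n - m - 1) * deriv D z * Y z ^ m)) * D z = of_nat n * (D z ^ (n - 1) * D z) * deriv D z"
    by (simp add: mult_ac)
  moreover have "D z ^ (n - 1) * D z = X z ^ (n - 1) * X z + Y z ^ (m - 1) * Y z * D z ^ (n - m)"
    using eq[of z] mn power_minus_mult[of n "D z"] power_minus_mult[of n "X z"] power_minus_mult[of m "Y z"]
    by simp
  moreover have "of_nat (n - m) * D z ^ (n - m - 1) * D z = (of_nat n - of_nat m) * D z ^ (n - m)"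
    using mn power_minus_mult[of "n - m" "D z"]
    by (cases "n = m") (simp_all add: of_nat_diff mult.assoc)
  moreover have "Y z ^ m = Y z ^ (m - 1) * Y z" using mn power_minus_mult[of m "Y z"] by simp
  moreover have "n' * Xp * (X' * D - X * D') + m' * Yp * E * (Y' * D - Y * D') = 0"
    if "(n' * Xp * X' + (m' * Yp * Y' * E + d * E1 * D' * Ym)) * D = n' * Dn * D'"
       "Dn = Xp * X + Yp * Y * E" "d * E1 * D = (n' - m') * E" "Ym = Yp * Y"
    for n' m' d X X' Xp Y Y' Yp Ym D D' Dn E E1 :: complex
    using that by algebra
  ultimately show ?thesis by blast
qed

text \<open>
  Here \<open>\<Phi> D ^ k\<close> is the pullback of \<open>\<omega>\<close>, so that the conclusions are
  \<open>x' = m y ^ (m - 1) \<Phi> D ^ k\<close> and \<open>y' = - n x ^ (n - 1) \<Phi> D ^ k\<close> for \<open>x = X / D\<close> and \<open>y = Y / D\<close>.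
  What has to be shown is that \<open>\<omega>\<close> is holomorphic and vanishes at the poles to such an order that it may
  be divided by \<open>D ^ k\<close>. At a zero of \<open>Y\<close> one uses the expression of \<open>\<omega>\<close> through \<open>dy\<close> instead of \<open>dx\<close>. At a zero
  of \<open>D\<close> the case \<open>m = n\<close> has no denominator left; for \<open>m < n\<close> there remains one factor \<open>D\<close>, and the
  relation forces \<open>X\<close> to vanish there too, that is, \<open>x\<close> has a pole of smaller order than \<open>y\<close>.
\<close>
lemma fermat_holomorphic_form:
  assumes hol: "X holomorphic_on UNIV" "Y holomorphic_on UNIV" "D holomorphic_on UNIV"
    and mn: "m \<le> n" "m \<ge> 3"
    and eq: "\<And>z. X z ^ n + Y z ^ m * D z ^ (n - m) = D z ^ n"
    and cop: "\<And>z. \<not> (Y z = 0 \<and> D z = 0)"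
    and D0: "D d \<noteq> 0" and Y0: "Y y \<noteq> 0"
  defines "k \<equiv> (if m = n then m - 3 else m - 2)"
  obtains \<Phi> where "\<Phi> holomorphic_on UNIV"
    "\<And>z. D z \<noteq> 0 \<Longrightarrow> deriv X z * D z - X z * deriv D z = \<Phi> z * of_nat m * (Y z / D z) ^ (m - 1) * D z ^ (k + 2)"
    "\<And>z. D z \<noteq> 0 \<Longrightarrow> deriv Y z * D z - Y z * deriv D z = - (\<Phi> z * of_nat n * (X z / D z) ^ (n - 1) * D z ^ (k + 2))"
proof -
  (* The power of D that remains in the denominator of Phi. *)
  define e :: nat where "e = (if m = n then 0 else 1)"
  have ke: "k + 2 = m - 1 + e" using mn by (auto simp: k_def e_def)
  define W where "W = (\<lambda>z. deriv X z * D z - X z * deriv D z)"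
  define V where "V = (\<lambda>z. deriv Y z * D z - Y z * deriv D z)"
  define Q where "Q = (\<lambda>z. of_nat m * Y z ^ (m - 1) * D z ^ e)"
  have holW: "W holomorphic_on UNIV" and holV: "V holomorphic_on UNIV" and holQ: "Q holomorphic_on UNIV"
    unfolding W_def V_def Q_def using hol by (auto intro!: holomorphic_intros)
  note cont = holomorphic_on_imp_continuous_on[OF hol(1)] holomorphic_on_imp_continuous_on[OF hol(2)]
    holomorphic_on_imp_continuous_on[OF hol(3)]
    holomorphic_on_imp_continuous_on[OF holW] holomorphic_on_imp_continuous_on[OF holV]
  have lim: "f \<midarrow>z\<rightarrow> f z" if "continuous_on UNIV f" for f :: "complex \<Rightarrow> complex" and z
    using that by (auto simp: continuous_on_def)
  have rel: "of_nat n * X z ^ (n - 1) * W z + of_nat m * Y z ^ (m - 1) * D z ^ (n - m) * V z = 0" for z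
    unfolding W_def V_def using mn by (intro fermat_wronskian_relation[OF hol _ _ eq]) auto
  obtain q where q: "Q q \<noteq> 0"
  proof -
    have "\<forall>\<^sub>F w in at 0. Y w \<noteq> 0 \<and> D w \<noteq> 0"
      using entire_eventually_nonzero[OF hol(2) Y0, of 0] entire_eventually_nonzero[OF hol(3) D0, of 0]
      by eventually_elim auto
    from eventually_happens[OF this] obtain w where "Y w \<noteq> 0" "D w \<noteq> 0" by auto
    thus ?thesis using mn by (intro that[of w]) (auto simp: Q_def)
  qed
  have limits: "\<exists>c. (\<lambda>w. W w / Q w) \<midarrow>z\<rightarrow> c" if z: "Q z = 0" for z
  proof (cases "Y z = 0")
    case True
    hence Dz: "D z \<noteq> 0" using cop by auto
    hence Xz: "X z \<noteq> 0" using eq[of z] True mn by (auto simp: power_0_left)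
    have evX: "\<forall>\<^sub>F w in at z. X w \<noteq> 0" and evD: "\<forall>\<^sub>F w in at z. D w \<noteq> 0" and evY: "\<forall>\<^sub>F w in at z. Y w \<noteq> 0"
      by (rule entire_eventually_nonzero[OF hol(1) Xz] entire_eventually_nonzero[OF hol(3) Dz]
          entire_eventually_nonzero[OF hol(2) Y0])+
    have "\<forall>\<^sub>F w in at z. W w / Q w = - (D w ^ (n - m) * V w) / (of_nat n * X w ^ (n - 1) * D w ^ e)"
      using evX evD evY
    proof eventually_elim
      case (elim w)
      have "W w * (of_nat n * X w ^ (n - 1)) = - (D w ^ (n - m) * V w) * (of_nat m * Y w ^ (m - 1))"
        using rel[of w] by (simp add: eq_neg_iff_add_eq_0 mult_ac)
      moreover have "of_nat n * X w ^ (n - 1) \<noteq> 0" "of_nat m * Y w ^ (m - 1) \<noteq> 0" "D w ^ e \<noteq> 0"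
        using elim mn by auto
      moreover have "u / (b * d) = v / (a * d)" if "u * a = v * b" "a \<noteq> 0" "b \<noteq> 0" "d \<noteq> 0" for a b d u v :: complex
        using that by (simp add: frac_eq_eq)
      ultimately show ?case unfolding Q_def by blast
    qed
    moreover have "(\<lambda>w. - (D w ^ (n - m) * V w) / (of_nat n * X w ^ (n - 1) * D w ^ e))
        \<midarrow>z\<rightarrow> - (D z ^ (n - m) * V z) / (of_nat n * X z ^ (n - 1) * D z ^ e)"
      using Xz Dz mn by (intro tendsto_intros lim cont) auto
    ultimately show ?thesis by (subst tendsto_cong) auto
  next
    case False
    hence Dz: "D z = 0" and e1: "e \<noteq> 0" using z mn by (auto simp: Q_def)
    hence nm: "m < n" using mn by (auto simp: e_def split: if_splits)
    hence Xz: "X z = 0" using eq[of z] Dz mn by (auto simp: power_0_left)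
    obtain c where c: "(\<lambda>w. X w * deriv D w / D w) \<midarrow>z\<rightarrow> c"
      using tendsto_mult_logderiv_at_common_zero[OF hol(1) Xz hol(3) Dz D0] by blast
    have "\<forall>\<^sub>F w in at z. W w / Q w = (deriv X w - X w * deriv D w / D w) / (of_nat m * Y w ^ (m - 1))"
      using entire_eventually_nonzero[OF hol(3) D0]
    proof eventually_elim
      case (elim w)
      have "W w = (deriv X w - X w * deriv D w / D w) * D w" using elim by (simp add: W_def field_simps)
      moreover have "Q w = of_nat m * Y w ^ (m - 1) * D w" using nm by (simp add: Q_def e_def)
      ultimately show ?case using elim by simp
    qed
    moreover have "(\<lambda>w. (deriv X w - X w * deriv D w / D w) / (of_nat m * Y w ^ (m - 1)))
        \<midarrow>z\<rightarrow> (deriv X z - c) / (of_nat m * Y z ^ (m - 1))"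
      using False mn hol
      by (intro tendsto_intros lim cont c holomorphic_on_imp_continuous_on holomorphic_deriv) auto
    ultimately show ?thesis by (subst tendsto_cong) auto
  qed
  obtain \<Phi> where \<Phi>: "\<Phi> holomorphic_on UNIV" "\<And>z. W z = \<Phi> z * Q z"
    using entire_quotient_if_limits[OF holW holQ q limits] by blast
  have V: "D z ^ (n - m) * V z = - (\<Phi> z * of_nat n * X z ^ (n - 1) * D z ^ e)" for z
  proof (rule eq_everywhere_if_eq_off_zeros[OF hol(2) Y0, where z = z and
        u = "\<lambda>z. D z ^ (n - m) * V z" and v = "\<lambda>z. - (\<Phi> z * of_nat n * X z ^ (n - 1) * D z ^ e)"])
    fix z assume "Y z \<noteq> 0"
    have "(of_nat m * Y z ^ (m - 1)) * (D z ^ (n - m) * V z + \<Phi> z * of_nat n * X z ^ (n - 1) * D z ^ e) = 0"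
      using rel[of z] unfolding \<Phi>(2) Q_def by (simp add: algebra_simps)
    hence "D z ^ (n - m) * V z + \<Phi> z * of_nat n * X z ^ (n - 1) * D z ^ e = 0"
      using \<open>Y z \<noteq> 0\<close> mn by simp
    thus "D z ^ (n - m) * V z = - (\<Phi> z * of_nat n * X z ^ (n - 1) * D z ^ e)"
      by (simp add: eq_neg_iff_add_eq_0)
  qed (use hol holV \<Phi>(1) in \<open>auto intro!: holomorphic_on_imp_continuous_on holomorphic_intros\<close>)
  show ?thesis
  proof (rule that[OF \<Phi>(1)])
    fix z assume Dz: "D z \<noteq> 0"
    have "Y z = (Y z / D z) * D z" "X z = (X z / D z) * D z" using Dz by auto
    hence Yp: "Y z ^ (m - 1) = (Y z / D z) ^ (m - 1) * D z ^ (m - 1)"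
      and Xp: "X z ^ (n - 1) = (X z / D z) ^ (n - 1) * D z ^ (n - 1)"
      by (metis power_mult_distrib)+
    show "deriv X z * D z - X z * deriv D z = \<Phi> z * of_nat m * (Y z / D z) ^ (m - 1) * D z ^ (k + 2)"
      using \<Phi>(2)[of z] unfolding W_def Q_def ke Yp power_add by (simp only: mult_ac)
    have "n - m + (k + 2) = n - 1 + e" using ke mn by simp
    hence "D z ^ (n - 1) * D z ^ e = D z ^ (n - m) * D z ^ (k + 2)" by (metis power_add)
    hence "D z ^ (n - m) * V z = D z ^ (n - m) * - (\<Phi> z * of_nat n * (X z / D z) ^ (n - 1) * D z ^ (k + 2))"
    proof -
      have "- (u * v * (x * p) * q) = r * - (u * v * x * s)" if "p * q = r * s" for u v x p q r s :: complex
        using that by algebra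
      with \<open>D z ^ (n - 1) * D z ^ e = D z ^ (n - m) * D z ^ (k + 2)\<close> show ?thesis
        unfolding V Xp by blast
    qed
    thus "deriv Y z * D z - Y z * deriv D z = - (\<Phi> z * of_nat n * (X z / D z) ^ (n - 1) * D z ^ (k + 2))"
      using mult_left_cancel[of "D z ^ (n - m)"] Dz unfolding V_def by (metis power_not_zero)
  qed
qed

text \<open>
  In homogeneous coordinates \<open>(X, Y, D)\<close> the metric of negative curvature is
  \<open>|\<Phi>|\<^sup>2 (|X|\<^sup>2 + |Y|\<^sup>2 + |D|\<^sup>2) ^ k\<close>, which is smooth also at the zeros of \<open>D\<close>. The curvature
  estimate holds where \<open>D \<noteq> 0\<close> and extends by continuity. So the metric vanishes, and with \<open>\<Phi>\<close> the
  Wronskians of \<open>X\<close> and of \<open>Y\<close> with \<open>D\<close> vanish.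
\<close>
lemma fermat_entire_triple_proportional:
  assumes hol: "X holomorphic_on UNIV" "Y holomorphic_on UNIV" "D holomorphic_on UNIV"
    and mn: "m \<le> n" "m \<ge> 3" "n \<ge> 4"
    and eq: "\<And>z. X z ^ n + Y z ^ m * D z ^ (n - m) = D z ^ n"
    and cop: "\<And>z. \<not> (Y z = 0 \<and> D z = 0)"
    and D0: "D d \<noteq> 0" and Y0: "Y y \<noteq> 0"
  shows "\<exists>a b. \<forall>z. X z = a * D z \<and> Y z = b * D z"
proof -
  define k where "k = (if m = n then m - 3 else m - 2)"
  have k: "k > 0" using mn by (auto simp: k_def)
  obtain \<Phi> where \<Phi>: "\<Phi> holomorphic_on UNIV"
    "\<And>z. D z \<noteq> 0 \<Longrightarrow> deriv X z * D z - X z * deriv D z = \<Phi> z * of_nat m * (Y z / D z) ^ (m - 1) * D z ^ (k + 2)"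
    "\<And>z. D z \<noteq> 0 \<Longrightarrow> deriv Y z * D z - Y z * deriv D z = - (\<Phi> z * of_nat n * (X z / D z) ^ (n - 1) * D z ^ (k + 2))"
    using fermat_holomorphic_form[OF hol mn(1,2) eq cop D0 Y0] unfolding k_def by blast
  obtain c :: real where c: "c > 0" "\<And>x y :: complex. x ^ n + y ^ m = 1 \<Longrightarrow>
       c * (1 + (cmod x)\<^sup>2 + (cmod y)\<^sup>2) ^ (k + 2)
       \<le> (cmod (of_nat m * y ^ (m - 1)))\<^sup>2 + (cmod (of_nat n * x ^ (n - 1)))\<^sup>2
          + (cmod (of_nat n * x ^ n + of_nat m * y ^ m))\<^sup>2"
  proof -
    have "k + 2 = (if m = n then m - 1 else m)" using mn by (auto simp: k_def)
    from fermat_curve_curvature_bound[OF mn(1,2), folded this] show ?thesis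
      using that by blast
  qed
  define S where "S = (\<lambda>z. (cmod (X z))\<^sup>2 + (cmod (Y z))\<^sup>2 + (cmod (D z))\<^sup>2)"
  define F where "F = (\<lambda>i::nat. if i = 0 then X else if i = 1 then Y else D)"
  have sumF: "(\<Sum>i\<in>{0,1,2}. u (F i)) = u X + u Y + u D" for u :: "(complex \<Rightarrow> complex) \<Rightarrow> 'a :: comm_monoid_add"
    by (simp add: F_def add_ac)
  have curv: "c * ((cmod (\<Phi> z))\<^sup>2 * S z ^ (k + 2)) \<le>
      (cmod (deriv X z * D z - X z * deriv D z))\<^sup>2 + (cmod (deriv Y z * D z - Y z * deriv D z))\<^sup>2
      + (cmod (X z * deriv Y z - Y z * deriv X z))\<^sup>2" for z
  proof (rule le_everywhere_if_le_off_zeros[OF hol(3) D0, where z = z and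
        u = "\<lambda>z. c * ((cmod (\<Phi> z))\<^sup>2 * S z ^ (k + 2))" and
        v = "\<lambda>z. (cmod (deriv X z * D z - X z * deriv D z))\<^sup>2 + (cmod (deriv Y z * D z - Y z * deriv D z))\<^sup>2
               + (cmod (X z * deriv Y z - Y z * deriv X z))\<^sup>2"])
    fix z assume Dz: "D z \<noteq> 0"
    define x y where "x = X z / D z" and "y = Y z / D z"
    have Xz: "X z = x * D z" and Yz: "Y z = y * D z" using Dz by (simp_all add: x_def y_def)
    have Dn: "D z ^ n = D z ^ m * D z ^ (n - m)" using mn by (simp flip: power_add)
    have "(x ^ n + y ^ m) * D z ^ n = X z ^ n + Y z ^ m * D z ^ (n - m)"
      unfolding Xz Yz power_mult_distrib distrib_right
      by (simp add: Dn mult_ac)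
    hence xy: "x ^ n + y ^ m = 1" using eq[of z] Dz by simp
    have xn: "x ^ n = x * x ^ (n - 1)" and ym: "y ^ m = y * y ^ (m - 1)"
      using mn by (metis power_minus_mult mult.commute gr0I not_numeral_le_zero)+
    define t where "t = of_nat n * x ^ n + of_nat m * y ^ m"
    note W = \<Phi>(2)[OF Dz, folded x_def y_def] and V = \<Phi>(3)[OF Dz, folded x_def y_def]
    have "D z * (X z * deriv Y z - Y z * deriv X z) =
       X z * (deriv Y z * D z - Y z * deriv D z) - Y z * (deriv X z * D z - X z * deriv D z)"
      by algebra
    also have "\<dots> = D z * - (\<Phi> z * (of_nat n * x ^ n + of_nat m * y ^ m) * D z ^ (k + 2))"
      unfolding W V unfolding Xz Yz xn ym by algebra
    finally have T: "X z * deriv Y z - Y z * deriv X z = - (\<Phi> z * (of_nat n * x ^ n + of_nat m * y ^ m) * D z ^ (k + 2))"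
      using mult_left_cancel[OF Dz] by blast
    have "S z = (1 + (cmod x)\<^sup>2 + (cmod y)\<^sup>2) * (cmod (D z))\<^sup>2"
      unfolding S_def Xz Yz by (simp add: norm_mult power_mult_distrib algebra_simps)
    hence "c * ((cmod (\<Phi> z))\<^sup>2 * S z ^ (k + 2))
        = (cmod (\<Phi> z) * cmod (D z) ^ (k + 2))\<^sup>2 * (c * (1 + (cmod x)\<^sup>2 + (cmod y)\<^sup>2) ^ (k + 2))"
      by (simp only: power_mult_distrib power_mult[symmetric] mult_ac)
    also have "\<dots> \<le> (cmod (\<Phi> z) * cmod (D z) ^ (k + 2))\<^sup>2 *
       ((cmod (of_nat m * y ^ (m - 1)))\<^sup>2 + (cmod (of_nat n * x ^ (n - 1)))\<^sup>2
          + (cmod (of_nat n * x ^ n + of_nat m * y ^ m))\<^sup>2)"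
      by (intro mult_left_mono c xy) auto
    also have "\<dots> = (cmod (\<Phi> z * of_nat m * y ^ (m - 1) * D z ^ (k + 2)))\<^sup>2
        + (cmod (- (\<Phi> z * of_nat n * x ^ (n - 1) * D z ^ (k + 2))))\<^sup>2
        + (cmod (- (\<Phi> z * (of_nat n * x ^ n + of_nat m * y ^ m) * D z ^ (k + 2))))\<^sup>2"
      unfolding t_def[symmetric] norm_minus_cancel norm_mult norm_power power_mult_distrib distrib_left
      by (simp only: mult_ac)
    finally show "c * ((cmod (\<Phi> z))\<^sup>2 * S z ^ (k + 2)) \<le>
      (cmod (deriv X z * D z - X z * deriv D z))\<^sup>2 + (cmod (deriv Y z * D z - Y z * deriv D z))\<^sup>2
      + (cmod (X z * deriv Y z - Y z * deriv X z))\<^sup>2"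
      unfolding W V T .
  qed (unfold S_def, (intro continuous_intros holomorphic_on_imp_continuous_on holomorphic_deriv hol \<Phi>(1) open_UNIV)+)
  have zero: "(cmod (\<Phi> z))\<^sup>2 * S z ^ k = 0" for z
  proof -
    have "(cmod (\<Phi> z))\<^sup>2 * (\<Sum>i\<in>{0,1,2}. (cmod (F i z))\<^sup>2) ^ k = 0"
    proof (rule negative_curvature_imp_zero[OF _ \<Phi>(1) k c(1)])
      fix w
      show "c * ((cmod (\<Phi> w))\<^sup>2 * (\<Sum>i\<in>{0,1,2}. (cmod (F i w))\<^sup>2) ^ (k + 2))
         \<le> (\<Sum>i\<in>{0,1,2}. (cmod (F i w))\<^sup>2) * (\<Sum>i\<in>{0,1,2}. (cmod (deriv (F i) w))\<^sup>2)
            - (cmod (\<Sum>i\<in>{0,1,2}. cnj (F i w) * deriv (F i) w))\<^sup>2"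
        using curv[of w] unfolding sumF[of "\<lambda>f. (cmod (f w))\<^sup>2"] sumF[of "\<lambda>f. (cmod (deriv f w))\<^sup>2"]
          sumF[of "\<lambda>f. cnj (f w) * deriv f w"] lagrange_identity_3 S_def .
    qed (use hol in \<open>auto simp: F_def\<close>)
    thus ?thesis unfolding sumF[of "\<lambda>f. (cmod (f z))\<^sup>2"] S_def .
  qed
  have \<Phi>0: "\<Phi> z = 0" if "D z \<noteq> 0" for z
  proof -
    have "S z > 0" using that unfolding S_def by (intro add_nonneg_pos add_nonneg_nonneg) auto
    thus ?thesis using zero[of z] by simp
  qed
  have "deriv X z * D z - X z * deriv D z = 0" for z
    by (rule eq_everywhere_if_eq_off_zeros[OF hol(3) D0, where v = "\<lambda>_. 0"])
       (use hol \<Phi> \<Phi>0 in \<open>auto intro!: holomorphic_on_imp_continuous_on holomorphic_intros\<close>)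
  then obtain a where a: "\<And>z. X z = a * D z"
    using proportional_if_wronskian_zero[OF hol(1) hol(3) D0] by blast
  have "deriv Y z * D z - Y z * deriv D z = 0" for z
    by (rule eq_everywhere_if_eq_off_zeros[OF hol(3) D0, where v = "\<lambda>_. 0"])
       (use hol \<Phi> \<Phi>0 in \<open>auto intro!: holomorphic_on_imp_continuous_on holomorphic_intros\<close>)
  then obtain b where "\<And>z. Y z = b * D z"
    using proportional_if_wronskian_zero[OF hol(2) hol(3) D0] by blast
  with a show ?thesis by blast
qed

section \<open>Meromorphic functions on the Fermat curve\<close>

text \<open>
  Near any point the values lie in the finite set of \<open>n\<close>-th roots of \<open>c\<close>, so one of them is taken
  frequently.
\<close>
lemma constant_if_power_constant:
  assumes F: "F nicely_meromorphic_on UNIV" and n: "n > 0"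
    and ev: "\<forall>\<^sub>\<approx>z. F z ^ n = c"
  obtains a where "\<And>z. F z = a"
proof -
  have "\<forall>\<^sub>F z in at 0. \<exists>w\<in>{w. w ^ n = c}. F z = w"
    using eventually_cosparse_imp_eventually_at[OF ev, of 0] by simp
  hence "\<exists>\<^sub>F z in at 0. \<exists>w\<in>{w. w ^ n = c}. F z = w"
    by (intro eventually_frequently) auto
  then obtain w where "\<exists>\<^sub>F z in at 0. F z = w"
    using frequently_bex_finite[of "{w. w ^ n = c}" "\<lambda>z w. F z = w"] finite_nth_roots[OF n] by blast
  from frequently_eq_meromorphic_imp_constant[OF this F] show ?thesis using that by auto
qed

lemma entire_if_power_eq_entire:
  assumes X: "X nicely_meromorphic_on UNIV" and P: "P holomorphic_on UNIV" and n: "n > 0"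
    and ev: "\<forall>\<^sub>\<approx>z. X z ^ n = P z"
  shows "X holomorphic_on UNIV"
proof -
  have "X analytic_on {z}" for z
  proof (rule nicely_meromorphic_on_imp_analytic_at[OF X])
    show "\<not> is_pole X z"
    proof
      assume "is_pole X z"
      hence "filterlim (\<lambda>z. X z ^ n) at_infinity (at z)"
        unfolding is_pole_def by (rule Limits.filterlim_power_at_infinity[OF _ n])
      hence "filterlim P at_infinity (at z)"
        using eventually_cosparse_imp_eventually_at[OF ev, of z UNIV] by (simp cong: filterlim_cong)
      hence "is_pole P z" by (simp add: is_pole_def)
      with not_is_pole_holomorphic[OF open_UNIV _ P, of z] show False by simp
    qed
  qed auto
  thus ?thesis using analytic_on_analytic_at analytic_imp_holomorphic by blast
qed

lemma entire_eq_if_eventually_eq: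
  assumes P: "P holomorphic_on UNIV" and Q: "Q holomorphic_on UNIV" and ev: "\<forall>\<^sub>\<approx>z. P z = Q z"
  shows "P z = Q z"
proof -
  have "P \<midarrow>z\<rightarrow> P z" "Q \<midarrow>z\<rightarrow> Q z"
    using holomorphic_on_imp_continuous_on[OF P] holomorphic_on_imp_continuous_on[OF Q]
    by (auto simp: continuous_on_def)
  moreover have "P \<midarrow>z\<rightarrow> Q z \<longleftrightarrow> Q \<midarrow>z\<rightarrow> Q z"
    by (rule tendsto_cong[OF eventually_cosparse_imp_eventually_at[OF ev]]) auto
  ultimately show ?thesis using LIM_unique by blast
qed

text \<open>
  Weierstrass factorisation supplies a coprime representation \<open>G = Y / D\<close>. Since \<open>m \<le> n\<close>, the poles of
  \<open>F\<close> have at most the order of those of \<open>G\<close>, so the same denominator serves for \<open>F\<close>: the \<open>n\<close>-th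
  power of \<open>F D\<close> is entire.
\<close>
theorem fermat_meromorphic_constant:
  assumes F: "F nicely_meromorphic_on UNIV" and G: "G nicely_meromorphic_on UNIV"
    and mn: "m \<le> n" "m \<ge> 3" "n \<ge> 4"
    and eq: "\<forall>\<^sub>\<approx>z. F z ^ n + G z ^ m = 1"
  shows "\<exists>a b. (\<forall>z. F z = a) \<and> (\<forall>z. G z = b)"
proof (cases "\<forall>z. G z = 0")
  case True
  have "\<forall>\<^sub>\<approx>z. F z ^ n = 1"
    using eq by eventually_elim (use True mn in \<open>auto simp: power_0_left\<close>)
  then obtain a where "\<And>z. F z = a"
    using constant_if_power_constant[OF F, of n 1] mn by auto
  with True show ?thesis by auto
next
  case False
  then obtain y where y: "G y \<noteq> 0" by blast
  obtain h f1 D where W: "h holomorphic_on UNIV" "f1 holomorphic_on UNIV" "D holomorphic_on UNIV"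
    "\<And>z. f1 z = 0 \<longleftrightarrow> \<not> is_pole G z \<and> G z = 0" "\<And>z. D z = 0 \<longleftrightarrow> is_pole G z"
    "\<And>z. h z \<noteq> 0" "\<And>z. G z = h z * f1 z / D z"
    using weierstrass_factorization_meromorphic_UNIV[OF G] by metis
  define Y where "Y = (\<lambda>z. h z * f1 z)"
  have holY: "Y holomorphic_on UNIV" unfolding Y_def using W by (auto intro: holomorphic_intros)
  have GY: "G z = Y z / D z" for z by (simp add: Y_def W(7))
  have cop: "\<not> (Y z = 0 \<and> D z = 0)" for z using W(4,5,6) by (auto simp: Y_def)
  have Y0: "Y y \<noteq> 0" and D0: "D y \<noteq> 0" using y GY[of y] by auto
  have evD: "\<forall>\<^sub>\<approx>z. D z \<noteq> 0"
    using entire_eventually_nonzero[OF W(3) D0] by (simp add: eventually_cosparse_open_eq)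
  have meroF: "F meromorphic_on UNIV" using F by (simp add: nicely_meromorphic_on_def)
  have mero: "(\<lambda>z. F z * D z) meromorphic_on UNIV"
    using W(3) by (intro meromorphic_intros meroF analytic_on_imp_meromorphic_on) (auto simp: analytic_on_open)
  define X where "X = remove_sings (\<lambda>z. F z * D z)"
  have X: "X nicely_meromorphic_on UNIV" unfolding X_def by (rule remove_sings_nicely_meromorphic[OF mero])
  have evX: "\<forall>\<^sub>\<approx>z. X z = F z * D z"
    unfolding X_def by (rule eventually_remove_sings_eq[OF mero])
  have ev: "\<forall>\<^sub>\<approx>z. X z ^ n = D z ^ n - Y z ^ m * D z ^ (n - m)"
    using eq evX evD
  proof eventually_elim
    case (elim z)
    have Dn: "D z ^ n = D z ^ m * D z ^ (n - m)" using mn by (simp flip: power_add)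
    have "X z ^ n + G z ^ m * D z ^ n = (F z ^ n + G z ^ m) * D z ^ n"
      unfolding elim(2) by (simp add: power_mult_distrib algebra_simps)
    moreover have "G z ^ m * D z ^ n = Y z ^ m * D z ^ (n - m)"
      unfolding GY Dn using elim(3) by (simp add: power_divide)
    ultimately show ?case using elim(1) by (simp add: algebra_simps)
  qed
  have holR: "(\<lambda>z. D z ^ n - Y z ^ m * D z ^ (n - m)) holomorphic_on UNIV"
    by (intro holomorphic_intros W(3) holY)
  have holX: "X holomorphic_on UNIV"
    by (rule entire_if_power_eq_entire[OF X holR _ ev]) (use mn in auto)
  have eqX: "X z ^ n + Y z ^ m * D z ^ (n - m) = D z ^ n" for z
    using entire_eq_if_eventually_eq[OF holomorphic_on_power[OF holX] holR ev, of z] by simp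
  obtain a b where ab: "\<And>z. X z = a * D z" "\<And>z. Y z = b * D z"
    using fermat_entire_triple_proportional[OF holX holY W(3) mn eqX cop D0 Y0] by blast
  have "\<forall>\<^sub>\<approx>z. F z = a" using evX evD by eventually_elim (use ab in auto)
  hence "\<exists>\<^sub>F z in at 0. F z = a"
    by (intro eventually_frequently eventually_cosparse_imp_eventually_at) auto
  from frequently_eq_meromorphic_imp_constant[OF this F open_UNIV connected_UNIV UNIV_I UNIV_I]
  have Fa: "F z = a" for z .
  have "\<forall>\<^sub>\<approx>z. G z = b" using evD by eventually_elim (use ab GY in auto)
  hence "\<exists>\<^sub>F z in at 0. G z = b"
    by (intro eventually_frequently eventually_cosparse_imp_eventually_at) auto
  from frequently_eq_meromorphic_imp_constant[OF this G open_UNIV connected_UNIV UNIV_I UNIV_I]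
  have "G z = b" for z .
  with Fa show ?thesis by blast
qed

section \<open>Exponent two\<close>

lemma entire_eventually_neq_value:
  assumes L: "L holomorphic_on UNIV" "\<not> L constant_on UNIV"
  shows "\<forall>\<^sub>F w in at z. L w \<noteq> L z"
proof -
  obtain a where "L a - L z \<noteq> 0" using L(2) unfolding constant_on_def by (metis right_minus_eq)
  moreover have "(\<lambda>w. L w - L z) holomorphic_on UNIV" by (intro holomorphic_intros L)
  ultimately show ?thesis using entire_eventually_nonzero[of "\<lambda>w. L w - L z" a z] by simp
qed

text \<open>
  If \<open>f\<close> has a pole of order \<open>p\<close> at \<open>z\<close>, then \<open>(f \<circ> L) ^ m\<close> has a pole of order \<open>n p\<close> there, so \<open>f\<close>
  has a pole at \<open>L z\<close> whose order, multiplied by \<open>m\<close> and by the multiplicity of \<open>L\<close> at \<open>z\<close>, is \<open>n p\<close>.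
  As \<open>n < m\<close>, that order is smaller than \<open>p\<close>, and the descent along the orbit of \<open>z\<close> must stop.
\<close>
lemma no_poles_if_exponent_smaller:
  assumes f: "f nicely_meromorphic_on UNIV" and L: "L holomorphic_on UNIV" "\<not> L constant_on UNIV"
    and g: "g holomorphic_on UNIV" and nm: "0 < n" "n < m"
    and eq: "\<forall>\<^sub>\<approx>z. f z ^ n + f (L z) ^ m = exp (g z)"
  shows "\<not> is_pole f z"
proof -
  have mero: "f meromorphic_on A" for A
    using f meromorphic_on_subset[of f UNIV A] by (auto simp: nicely_meromorphic_on_def)
  have Lan: "L analytic_on A" and gan: "g analytic_on A" for A
    using L g by (auto simp: analytic_on_holomorphic)
  have step: "is_pole f (L z) \<and> zorder f z < zorder f (L z)" if z: "is_pole f z" for z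
  proof -
    have freqf: "\<exists>\<^sub>F w in at z. f w \<noteq> 0"
      by (intro eventually_frequently non_zero_neighbour_pole[OF z]) auto
    have neg: "zorder f z < 0"
      using mero by (intro isolated_pole_imp_neg_zorder z meromorphic_on_isolated_singularity) auto
    have ev: "\<forall>\<^sub>F w in at z. exp (g w) - f w ^ n = f (L w) ^ m"
      using eventually_cosparse_imp_eventually_at[OF eq, of z UNIV]
      by (auto elim!: eventually_mono simp: algebra_simps)
    have expan: "(\<lambda>w. exp (g w)) analytic_on {z}" using gan by (intro analytic_intros) auto
    have "zorder (\<lambda>w. exp (g w) - f w ^ n) z = zorder (\<lambda>w. f w ^ n) z"
    proof (rule zorder_diff2)
      show "zorder (\<lambda>w. f w ^ n) z < zorder (\<lambda>w. exp (g w)) z"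
        using zorder_power[OF mero freqf, of n] zorder_eq_0I[OF expan] neg nm by (simp add: mult_pos_neg)
      show "\<exists>\<^sub>F w in at z. exp (g w) \<noteq> 0" "\<exists>\<^sub>F w in at z. f w ^ n \<noteq> 0"
        using freqf by (auto elim: frequently_elim1)
      show "(\<lambda>w. exp (g w)) meromorphic_on {z}" by (rule analytic_on_imp_meromorphic_on[OF expan])
      show "(\<lambda>w. f w ^ n) meromorphic_on {z}" by (intro meromorphic_intros mero)
    qed
    hence ord: "zorder (\<lambda>w. f (L w) ^ m) z = int n * zorder f z"
      using zorder_cong[OF ev refl] zorder_power[OF mero freqf, of n] by simp
    have merofL: "(\<lambda>w. f (L w)) meromorphic_on {z}"
      by (rule meromorphic_on_compose[OF mero[of UNIV] Lan]) auto
    have nL: "\<forall>\<^sub>F w in at z. L w \<noteq> L z"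
      by (rule entire_eventually_neq_value[OF L])
    have polef: "filterlim (\<lambda>w. f (L w) ^ m) at_infinity (at z)"
    proof -
      have "zorder (\<lambda>w. f (L w) ^ m) z < 0" using ord neg nm by (simp add: mult_pos_neg)
      moreover have "\<forall>\<^sub>F w in at z. f (L w) ^ m \<noteq> 0"
      proof -
        have "filterlim (\<lambda>w. exp (g w) - f w ^ n) at_infinity (at z)"
        proof -
          have "filterlim (\<lambda>w. - (f w ^ n)) at_infinity (at z)"
            using Limits.filterlim_power_at_infinity[OF z[unfolded is_pole_def] nm(1)]
            by (simp add: filterlim_at_infinity_conv_norm_at_top)
          moreover have "(\<lambda>w. exp (g w)) \<midarrow>z\<rightarrow> exp (g z)"
            using analytic_at_imp_isCont[OF expan] by (rule isContD)
          ultimately show ?thesis using tendsto_add_filterlim_at_infinity by fastforce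
        qed
        from filterlim_at_infinity_imp_eventually_ne[OF this, of 0] ev
        show ?thesis by eventually_elim auto
      qed
      ultimately have "is_pole (\<lambda>w. f (L w) ^ m) z"
        using merofL by (intro zorder_neg_imp_is_pole meromorphic_intros) auto
      thus ?thesis by (simp add: is_pole_def)
    qed
    have pole: "is_pole f (L z)"
    proof (rule ccontr)
      assume "\<not> is_pole f (L z)"
      hence "f analytic_on {L z}" by (intro nicely_meromorphic_on_imp_analytic_at[OF f]) auto
      hence "(\<lambda>w. f (L w) ^ m) analytic_on {z}"
        using analytic_on_compose[OF Lan[of "{z}"], of f] by (intro analytic_intros) (simp add: o_def)
      hence "\<not> is_pole (\<lambda>w. f (L w) ^ m) z" by (rule analytic_at_imp_no_pole)
      with polef show False by (simp add: is_pole_def)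
    qed
    have evf: "\<forall>\<^sub>F w in at (L z). f w \<noteq> 0" by (rule non_zero_neighbour_pole[OF pole])
    have comp: "zorder (\<lambda>w. f (L w)) z = zorder f (L z) * zorder (\<lambda>w. L w - L z) z"
      using zorder_compose'[of f L z] mero[of "{L z}"] Lan evf nL
      by (simp add: o_def meromorphic_at_iff)
    have freqfL: "\<exists>\<^sub>F w in at z. f (L w) \<noteq> 0"
    proof -
      have "\<forall>\<^sub>F w in at z. f (L w) ^ m \<noteq> 0"
        using filterlim_at_infinity_imp_eventually_ne[OF polef, of 0] .
      hence "\<forall>\<^sub>F w in at z. f (L w) \<noteq> 0" by eventually_elim (use nm in auto)
      thus ?thesis by (intro eventually_frequently) auto
    qed
    have kpos: "zorder (\<lambda>w. L w - L z) z > 0"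
    proof -
      have "\<exists>\<^sub>F w in at z. L w - L z \<noteq> 0"
        using nL by (intro eventually_frequently) auto
      moreover have "(\<lambda>w. L w - L z) analytic_on {z}" using Lan by (intro analytic_intros)
      ultimately show ?thesis using zorder_pos_iff'[of "\<lambda>w. L w - L z" z] by simp
    qed
    have neg': "zorder f (L z) < 0"
      using mero by (intro isolated_pole_imp_neg_zorder pole meromorphic_on_isolated_singularity) auto
    have "int m * (zorder f (L z) * zorder (\<lambda>w. L w - L z) z) = int n * zorder f z"
      using zorder_power[OF merofL freqfL, of m] comp ord by simp
    moreover have "zorder f (L z) * zorder (\<lambda>w. L w - L z) z \<le> zorder f (L z) * 1"
      using kpos neg' by (intro mult_left_mono_neg) auto
    hence "int m * (zorder f (L z) * zorder (\<lambda>w. L w - L z) z) \<le> int m * zorder f (L z)"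
      by (intro mult_left_mono) auto
    moreover have "int m * zorder f (L z) < int n * zorder f (L z)"
      using nm neg' by (intro mult_strict_right_mono_neg) auto
    ultimately have "int n * zorder f z < int n * zorder f (L z)" by linarith
    with pole nm show ?thesis by simp
  qed
  show ?thesis
  proof
    assume "is_pole f z"
    thus False
    proof (induction "nat (- zorder f z)" arbitrary: z rule: less_induct)
      case less
      have neg: "zorder f (L z) < 0"
        using step[OF less.prems] mero
        by (intro isolated_pole_imp_neg_zorder meromorphic_on_isolated_singularity) auto
      show False
        by (rule less.hyps[of "L z"]) (use step[OF less.prems] neg in auto)
    qed
  qed
qed

text \<open>
  The two factors have no common zero, so every zero of \<open>F - 1\<close> has \<open>m\<close> times the order that it has as a
  zero of \<open>G\<close>. An entire function with the same zeros and each multiplicity divided by \<open>m\<close> is the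
  numerator in the Weierstrass factorisation of \<open>(F - 1) / G ^ (m - 1)\<close>: this quotient has order \<open>ord G\<close> at the zeros of
  \<open>F - 1\<close>, and all other zeros of \<open>G\<close> become poles.
\<close>
lemma entire_root_of_factor:
  assumes F: "F holomorphic_on UNIV" and G: "G holomorphic_on UNIV" and m: "m \<ge> 2"
    and eq: "\<And>z. (F z - 1) * (F z + 1) = - (G z ^ m)" and G0: "G a \<noteq> 0"
  obtains U where "U holomorphic_on UNIV" "\<And>z. F z - 1 = U z ^ m"
proof -
  define E where "E = (\<lambda>z. F z - 1)"
  have E: "E holomorphic_on UNIV" unfolding E_def by (intro holomorphic_intros F)
  have E0: "E a \<noteq> 0" using eq[of a] G0 by (auto simp: E_def)
  have an: "E analytic_on A" "F analytic_on A" "G analytic_on A" for A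
    using E F G by (auto simp: analytic_on_holomorphic)
  have fE: "\<exists>\<^sub>F w in at z. E w \<noteq> 0" and fG: "\<exists>\<^sub>F w in at z. G w \<noteq> 0" for z
    using entire_eventually_nonzero[OF E E0] entire_eventually_nonzero[OF G G0]
    by (auto intro!: eventually_frequently)
  have EG: "E z = 0 \<Longrightarrow> G z = 0" for z using eq[of z] m by (auto simp: E_def)
  have ord: "zorder E z = int m * zorder G z" if z: "E z = 0" for z
  proof -
    have "F z + 1 \<noteq> 0" using z by (auto simp: E_def)
    hence o1: "zorder (\<lambda>w. F w + 1) z = 0"
      using an by (intro zorder_eq_0I analytic_intros) auto
    have "\<forall>\<^sub>F w in at z. F w + 1 \<noteq> 0"
      using \<open>F z + 1 \<noteq> 0\<close> F by (intro entire_eventually_nonzero[of _ z]) (auto intro: holomorphic_intros)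
    hence f1: "\<exists>\<^sub>F w in at z. F w + 1 \<noteq> 0" by (intro eventually_frequently) auto
    have "zorder (\<lambda>w. E w * (F w + 1)) z = zorder E z + zorder (\<lambda>w. F w + 1) z"
      using an by (intro zorder_mult fE f1 analytic_on_imp_meromorphic_on analytic_intros) auto
    also have "(\<lambda>w. E w * (F w + 1)) = (\<lambda>w. - (G w ^ m))" using eq by (simp add: E_def)
    also have "zorder \<dots> z = zorder (\<lambda>w. G w ^ m) z" by simp
    also have "\<dots> = int m * zorder G z" using an by (intro zorder_power fG analytic_on_imp_meromorphic_on)
    finally show ?thesis using o1 by simp
  qed
  define Q where "Q = (\<lambda>z. E z / G z ^ (m - 1))"
  have Qm: "Q meromorphic_on UNIV"
    unfolding Q_def using an by (intro meromorphic_intros analytic_on_imp_meromorphic_on)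
  have Qord: "zorder Q z = zorder G z" if z: "E z = 0" for z
  proof -
    have "zorder Q z = zorder E z - zorder (\<lambda>w. G w ^ (m - 1)) z"
      unfolding Q_def using an fE fG[of z]
      by (intro zorder_divide analytic_on_imp_meromorphic_on analytic_intros) (auto elim: frequently_elim1)
    also have "zorder (\<lambda>w. G w ^ (m - 1)) z = int (m - 1) * zorder G z"
      using an by (intro zorder_power fG analytic_on_imp_meromorphic_on)
    finally show ?thesis using ord[OF z] m by (simp add: of_nat_diff algebra_simps)
  qed
  define R where "R = remove_sings Q"
  have R: "R nicely_meromorphic_on UNIV" unfolding R_def by (rule remove_sings_nicely_meromorphic[OF Qm])
  have evR: "\<forall>\<^sub>F w in at z. R w = Q w" for z
    unfolding R_def by (rule eventually_cosparse_imp_eventually_at[OF eventually_remove_sings_eq[OF Qm]]) auto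
  have evGn: "\<forall>\<^sub>F w in at z. G w \<noteq> 0" and evEn: "\<forall>\<^sub>F w in at z. E w \<noteq> 0" for z
    by (rule entire_eventually_nonzero[OF G G0] entire_eventually_nonzero[OF E E0])+
  have evRn: "\<forall>\<^sub>F w in at z. R w \<noteq> 0" for z
    using evR[of z] evGn[of z] evEn[of z] by eventually_elim (auto simp: Q_def)
  have Rord: "zorder R z = zorder G z" if "E z = 0" for z
    using zorder_cong[OF evR refl, of z] Qord[OF that] by simp
  obtain h f1 f2 where W: "f1 holomorphic_on UNIV"
    "\<And>z. f1 z = 0 \<longleftrightarrow> \<not> is_pole R z \<and> R z = 0" 
    "\<And>z. \<not> is_pole R z \<Longrightarrow> zorder f1 z = zorder R z"
    using weierstrass_factorization_meromorphic_UNIV[OF R] by metis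
  have Gpos: "zorder G z > 0" if "E z = 0" for z
    using zorder_pos_iff'[OF an(3) fG] EG[OF that] by simp
  have mR: "R meromorphic_on {z}" for z
    using R meromorphic_on_subset[of R UNIV "{z}"] by (auto simp: nicely_meromorphic_on_def)
  have RE: "\<not> is_pole R z \<and> R z = 0" if z: "E z = 0" for z
  proof -
    have np: "\<not> is_pole R z"
    proof
      assume "is_pole R z"
      hence "zorder R z < 0"
        using mR by (intro isolated_pole_imp_neg_zorder meromorphic_on_isolated_singularity) auto
      with Rord[OF z] Gpos[OF z] show False by simp
    qed
    hence "R analytic_on {z}" by (intro nicely_meromorphic_on_imp_analytic_at[OF R]) auto
    moreover have "\<exists>\<^sub>F w in at z. R w \<noteq> 0" using evRn by (intro eventually_frequently) auto
    ultimately show ?thesis using zorder_pos_iff'[of R z] Rord[OF z] Gpos[OF z] np by simp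
  qed
  have f1E: "f1 z = 0 \<longleftrightarrow> E z = 0" for z
  proof
    assume "f1 z = 0"
    hence R0: "\<not> is_pole R z" "R z = 0" using W(2) by auto
    show "E z = 0"
    proof (rule ccontr)
      assume Ez: "E z \<noteq> 0"
      have Ran: "R analytic_on {z}" by (intro nicely_meromorphic_on_imp_analytic_at[OF R] R0) auto
      have "(\<lambda>w. R w * G w ^ (m - 1)) \<midarrow>z\<rightarrow> R z * G z ^ (m - 1)"
        using Ran an by (intro isContD analytic_at_imp_isCont analytic_intros) auto
      moreover have "\<forall>\<^sub>F w in at z. R w * G w ^ (m - 1) = E w"
        using evR[of z] evGn[of z] by eventually_elim (auto simp: Q_def)
      ultimately have "E \<midarrow>z\<rightarrow> 0" using R0 by (simp add: tendsto_cong)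
      moreover have "E \<midarrow>z\<rightarrow> E z" using an by (intro isContD analytic_at_imp_isCont) auto
      ultimately show False using Ez LIM_unique by blast
    qed
  next
    assume "E z = 0"
    thus "f1 z = 0" using RE W(2) by blast
  qed
  have f1an: "f1 analytic_on A" for A using W(1) by (auto simp: analytic_on_holomorphic)
  have f1a: "f1 a \<noteq> 0" using f1E E0 by simp
  have ff1: "\<exists>\<^sub>F w in at z. f1 w \<noteq> 0" for z
    using entire_eventually_nonzero[OF W(1) f1a] by (auto intro!: eventually_frequently)
  have ord1: "zorder (\<lambda>w. f1 w ^ m) z = zorder E z" for z
  proof -
    have 1: "zorder (\<lambda>w. f1 w ^ m) z = int m * zorder f1 z"
      using f1an by (intro zorder_power ff1 analytic_on_imp_meromorphic_on)
    show ?thesis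
    proof (cases "E z = 0")
      case True
      thus ?thesis using 1 W(3)[of z] RE[OF True] Rord[OF True] ord[OF True] by simp
    next
      case False
      thus ?thesis using 1 zorder_eq_0I[OF an(1) False] zorder_eq_0I[OF f1an, of z] f1E[of z] by simp
    qed
  qed
  obtain k where k: "k holomorphic_on UNIV" "\<And>z. k z \<noteq> 0" "\<And>z. E z = k z * f1 z ^ m"
  proof (rule holomorphic_zorder_factorization[of E UNIV "\<lambda>w. f1 w ^ m"])
    show "(\<lambda>w. f1 w ^ m) holomorphic_on UNIV" by (rule holomorphic_on_power[OF W(1)])
    show "f1 z ^ m = 0 \<longleftrightarrow> E z = 0" for z using f1E[of z] m by auto
    fix k assume "k holomorphic_on UNIV" "\<And>z. z \<in> UNIV \<Longrightarrow> k z \<noteq> 0" "\<And>z. z \<in> UNIV \<Longrightarrow> E z = k z * f1 z ^ m"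
    thus ?thesis by (intro that[of k]) auto
  qed (use E ord1 in auto)
  obtain l where l: "l holomorphic_on UNIV" "\<And>z. k z = exp (l z)"
    using contractible_imp_holomorphic_log[OF k(1) contractible_UNIV k(2)] by (metis UNIV_I)
  show ?thesis
  proof (rule that[of "\<lambda>z. exp (l z / of_nat m) * f1 z"])
    show "(\<lambda>z. exp (l z / of_nat m) * f1 z) holomorphic_on UNIV"
      using m by (intro holomorphic_intros l W(1)) auto
    show "F z - 1 = (exp (l z / of_nat m) * f1 z) ^ m" for z
    proof -
      have "exp (l z / of_nat m) ^ m = exp (l z)" using m by (simp flip: exp_of_nat_mult)
      thus ?thesis using k(3)[of z] l(2)[of z] by (simp add: power_mult_distrib E_def)
    qed
  qed
qed

text \<open>
  For each \<open>s\<close> with \<open>s ^ m = - 1\<close> the linear form \<open>U - s V\<close> is a factor of \<open>U ^ m + V ^ m = c\<close> and so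
  has no zeros. Three such forms are linearly dependent, so the quotient of two of them is an entire
  function that omits two values, and Picard's theorem applies.
\<close>
lemma entire_fermat_sum_constant:
  assumes U: "U holomorphic_on UNIV" and V: "V holomorphic_on UNIV" and m: "m \<ge> 3"
    and c: "c \<noteq> 0" and eq: "\<And>z. U z ^ m + V z ^ m = c"
  shows "\<exists>b. \<forall>z. U z ^ m = b"
proof -
  define S where "S = {w::complex. w ^ m = -1}"
  have "card S = m" unfolding S_def using m by (intro card_nth_roots) auto
  hence "\<not> card S \<le> 2" using m by simp
  then obtain T where "T \<subseteq> S" "card T = 3" using m \<open>card S = m\<close> by (metis obtain_subset_with_card_n)
  then obtain s1 s2 s3 :: complex where s: "s1 ^ m = -1" "s2 ^ m = -1" "s3 ^ m = -1" "s1 \<noteq> s2" "s1 \<noteq> s3" "s2 \<noteq> s3"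
  proof -
    obtain x y z :: complex where "T = {x, y, z}" "x \<noteq> y" "y \<noteq> z" "x \<noteq> z"
      using \<open>card T = 3\<close> by (auto simp: card_3_iff)
    thus ?thesis using \<open>T \<subseteq> S\<close> by (intro that[of x y z]) (auto simp: S_def)
  qed
  have nz: "U z - s * V z \<noteq> 0" if "s ^ m = -1" for s z
  proof
    assume "U z - s * V z = 0"
    hence "U z ^ m = - (V z ^ m)" using that by (simp add: power_mult_distrib)
    thus False using eq[of z] c by simp
  qed
  define h where "h = (\<lambda>z. (U z - s1 * V z) / (U z - s3 * V z))"
  have h: "h holomorphic_on UNIV" unfolding h_def using nz[OF s(3)] by (intro holomorphic_intros U V) auto
  (* The value of the quotient h at which the third form U - s2 V would vanish. *)
  define q where "q = (s2 - s1) / (s2 - s3)"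
  have q: "q \<noteq> 0" "q \<noteq> 1" using s by (auto simp: q_def)
  have "h z \<noteq> q" for z
  proof
    assume "h z = q"
    hence "(U z - s1 * V z) * (s2 - s3) = (s2 - s1) * (U z - s3 * V z)"
      using nz[OF s(3)] s by (simp add: h_def q_def field_simps)
    hence "(s1 - s3) * (U z - s2 * V z) = 0" by algebra
    thus False using s nz[OF s(2)] by simp
  qed
  moreover have "h z \<noteq> 0" for z using nz[OF s(1)] nz[OF s(3)] by (simp add: h_def)
  ultimately have "range h \<inter> {0, q} = {}" by auto
  then obtain d where d: "h = (\<lambda>z. d)" using little_Picard[OF h, of 0 q] q by metis
  have Ud: "U z - s1 * V z = d * (U z - s3 * V z)" for z
    using fun_cong[OF d, of z] nz[OF s(3), of z] by (simp add: h_def field_simps)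
  have lin: "(1 - d) * U z = (s1 - d * s3) * V z" for z using Ud[of z] by (simp add: algebra_simps)
  show ?thesis
  proof (cases "d = 1")
    case True
    hence "V z = 0" for z using lin[of z] s by simp
    hence "U z ^ m = c" for z using eq[of z] m by (auto simp: power_0_left)
    thus ?thesis by blast
  next
    case False
    define t where "t = (s1 - d * s3) / (1 - d)"
    have Ut: "U z = t * V z" for z using lin[of z] False by (simp add: t_def field_simps)
    have "(t ^ m + 1) * V z ^ m = c" for z using eq[of z] unfolding Ut by (simp add: power_mult_distrib algebra_simps)
    moreover from this[of 0] c have "t ^ m + 1 \<noteq> 0" by auto
    ultimately have "V z ^ m = c / (t ^ m + 1)" for z by (simp add: field_simps)
    hence "U z ^ m = t ^ m * (c / (t ^ m + 1))" for z unfolding Ut by (simp add: power_mult_distrib)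
    thus ?thesis by blast
  qed
qed

lemma fermat_2_entire_constant:
  assumes F: "F holomorphic_on UNIV" and G: "G holomorphic_on UNIV" and m: "m \<ge> 3"
    and eq: "\<And>z. F z ^ 2 + G z ^ m = 1"
  shows "\<exists>a. \<forall>z. F z = a"
proof (cases "\<forall>z. G z = 0")
  case True
  have "F nicely_meromorphic_on UNIV"
    using F by (intro analytic_on_imp_nicely_meromorphic_on) (simp add: analytic_on_open)
  moreover have "F z ^ 2 = 1" for z using eq[of z] True m by (auto simp: power_0_left)
  hence "\<forall>\<^sub>\<approx>z. F z ^ 2 = 1" by simp
  ultimately show ?thesis using constant_if_power_constant[of F 2 1] by auto
next
  case False
  then obtain a where a: "G a \<noteq> 0" by auto
  have fac: "(u - 1) * (u + 1) = - w" if "u ^ 2 + w = 1" for u w :: complex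
    using that by algebra
  have "(F z - 1) * (F z + 1) = - (G z ^ m)" for z using fac[OF eq] .
  then obtain U where U: "U holomorphic_on UNIV" "\<And>z. F z - 1 = U z ^ m"
    using entire_root_of_factor[OF F G _ _ a, of m] m by auto
  have "(- F z - 1) * (- F z + 1) = - (G z ^ m)" for z using fac[of "- F z" "G z ^ m"] eq[of z] by simp
  then obtain V where V: "V holomorphic_on UNIV" "\<And>z. - F z - 1 = V z ^ m"
    using entire_root_of_factor[of "\<lambda>z. - F z", OF _ G _ _ a, of m] m F by (auto intro: holomorphic_intros)
  have "U z ^ m + V z ^ m = -2" for z by (simp flip: U(2) V(2))
  then obtain b where b: "\<And>z. U z ^ m = b" using entire_fermat_sum_constant[OF U(1) V(1) m, of "-2"] by auto
  have "F z = b + 1" for z using U(2)[of z] b[of z] by (simp add: algebra_simps)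
  thus ?thesis by blast
qed

section \<open>Entire semiconjugacies to an affine map\<close>

lemma entire_linear_growth_imp_affine:
  assumes "L holomorphic_on UNIV" "\<And>z. cmod z \<ge> r0 \<Longrightarrow> cmod (L z) \<le> C * cmod z"
  shows "\<exists>q c. \<forall>z. L z = q * z + c"
proof -
  have "L z = L 0 + deriv L 0 * z" for z
    using Liouville_polynomial[OF assms(1), of r0 C 1 z] assms(2) by simp
  thus ?thesis by (metis add.commute)
qed

text \<open>
  Normalised so that \<open>w1\<close> and \<open>w2\<close> become \<open>0\<close> and \<open>1\<close>, the function omits these two values on the disc of
  radius \<open>r\<close> and has norm at most \<open>1\<close> at the centre, so Schottky's theorem bounds it on the half disc.
  The exponent \<open>16\<close> is the value \<open>2 + 2 * 1 + 12 t / (1 - t)\<close> of Schottky's constant for \<open>t = 1 / 2\<close>.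
\<close>
lemma bounded_on_half_ball_if_spheres_not_covered:
  assumes L: "L holomorphic_on UNIV" and r: "r > 0" "cmod (L 0) \<le> K * r" and K: "K > 0"
    and w1: "cmod w1 = K * r" "w1 \<notin> L ` cball 0 r"
    and w2: "cmod w2 = 3 * (K * r)" "w2 \<notin> L ` cball 0 r"
    and z: "cmod z \<le> r / 2"
  shows "cmod (L z) \<le> K * (1 + 4 * exp (pi * exp (pi * 16))) * r"
proof -
  have Kr: "K * r > 0" using r K by simp
  have d: "cmod (w2 - w1) \<ge> 2 * (K * r)" "cmod (w2 - w1) \<le> 4 * (K * r)"
    using norm_triangle_ineq2[of w2 w1] norm_triangle_ineq4[of w2 w1] w1 w2 by linarith+
  hence ne: "w2 \<noteq> w1" using Kr by auto
  define h where "h = (\<lambda>\<zeta>. (L (of_real r * \<zeta>) - w1) / (w2 - w1))"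
  have "cmod (h (z / of_real r)) \<le> exp (pi * exp (pi * (2 + 2 * 1 + 12 * (1/2) / (1 - 1/2))))"
  proof (rule Schottky[where f = h])
    have "(\<lambda>\<zeta>. L (of_real r * \<zeta>)) holomorphic_on cball 0 1"
      using holomorphic_on_compose_gen[of "\<lambda>\<zeta>. of_real r * \<zeta>" "cball 0 1" L UNIV] L
      by (auto simp: o_def intro: holomorphic_intros)
    thus "h holomorphic_on cball 0 1"
      unfolding h_def using ne by (auto intro!: holomorphic_intros)
    have "cmod (L 0 - w1) \<le> 2 * (K * r)"
      using norm_triangle_ineq4[of "L 0" w1] r w1 by linarith
    thus "cmod (h 0) \<le> 1" using d ne by (simp add: h_def norm_divide divide_le_eq)
    show "\<not> (h \<zeta> = 0 \<or> h \<zeta> = 1)" if "\<zeta> \<in> cball 0 1" for \<zeta>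
    proof -
      have "of_real r * \<zeta> \<in> cball 0 r" using that r by (simp add: norm_mult mult_left_le)
      hence "L (of_real r * \<zeta>) \<noteq> w1" "L (of_real r * \<zeta>) \<noteq> w2" using w1 w2 by (metis image_eqI)+
      thus ?thesis using ne by (simp add: h_def)
    qed
    show "cmod (z / of_real r) \<le> 1/2" using z r by (simp add: norm_divide divide_le_eq)
  qed auto
  hence "cmod (L z - w1) \<le> exp (pi * exp (pi * 16)) * cmod (w2 - w1)"
    using r ne by (simp add: h_def norm_divide divide_le_eq)
  also have "\<dots> \<le> exp (pi * exp (pi * 16)) * (4 * (K * r))"
    using d by (intro mult_left_mono) auto
  finally have "cmod (L z - w1) \<le> exp (pi * exp (pi * 16)) * (4 * (K * r))" .
  thus ?thesis using norm_triangle_ineq2[of "L z" w1] w1 by (simp add: algebra_simps)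
qed

text \<open>
  If the circles of radius \<open>K r\<close> and \<open>3 K r\<close> were both not covered for all large \<open>r\<close>, then \<open>L\<close> would
  have linear growth. The factor \<open>3\<close> keeps the two omitted values apart.
\<close>
lemma entire_covers_large_sphere:
  assumes L: "L holomorphic_on UNIV" and na: "\<nexists>q c. \<forall>z. L z = q * z + c" and K: "K > 0"
  obtains r R where "r \<ge> r0" "r > 0" "R \<ge> K * r" "sphere 0 R \<subseteq> L ` cball 0 r"
proof (rule ccontr)
  assume nt: "\<not> thesis"
  note found = that
  have no: "\<not> sphere 0 R \<subseteq> L ` cball 0 r" if "r \<ge> r0" "r > 0" "R \<ge> K * r" for r R
    using found[OF that] nt by blast
  define r1 where "r1 = Max {r0, 1, cmod (L 0) / K}"
  have r1: "r1 \<ge> r0" "r1 \<ge> 1" "r1 \<ge> cmod (L 0) / K" by (simp_all add: r1_def)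
  have "cmod (L z) \<le> (K * (1 + 4 * exp (pi * exp (pi * 16))) * 2) * cmod z" if z: "cmod z \<ge> r1" for z
  proof -
    define r where "r = 2 * cmod z"
    have r: "r \<ge> r0" "r > 0" "r \<ge> cmod (L 0) / K" using z r1 by (auto simp: r_def)
    have "cmod (L 0) \<le> K * r" using r(3) K by (simp add: divide_le_eq mult.commute)
    moreover obtain w1 where "cmod w1 = K * r" "w1 \<notin> L ` cball 0 r"
      using no[of r "K * r"] r by (auto simp: subset_iff)
    moreover have "3 * (K * r) \<ge> K * r" using K r by simp
    then obtain w2 where "cmod w2 = 3 * (K * r)" "w2 \<notin> L ` cball 0 r"
      using no[of r "3 * (K * r)"] r by (auto simp: subset_iff)
    ultimately have "cmod (L z) \<le> K * (1 + 4 * exp (pi * exp (pi * 16))) * r"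
      using bounded_on_half_ball_if_spheres_not_covered[OF L r(2) _ K, of w1 w2 z] by (auto simp: r_def)
    thus ?thesis by (simp add: r_def mult_ac)
  qed
  with entire_linear_growth_imp_affine[OF L] na show False by blast
qed

text \<open>
  Schwarz's lemma, in the form that a function vanishing at \<open>0\<close> grows at least linearly in the radius.
\<close>
lemma maximum_modulus_scaling:
  assumes g: "g holomorphic_on UNIV" "g 0 = 0" and r: "0 < r" "r \<le> R"
    and M: "\<And>z. cmod z = R \<Longrightarrow> cmod (g z) \<le> M" and z: "cmod z \<le> r"
  shows "R * cmod (g z) \<le> r * M"
proof -
  obtain h where h: "h holomorphic_on ball 0 (R + 1)" "\<And>z. cmod z < R + 1 \<Longrightarrow> g z = z * h z"
    using Schwarz3[OF holomorphic_on_subset[OF g(1) subset_UNIV] g(2)] by metis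
  have R: "R > 0" using r by simp
  have M0: "M \<ge> 0" using M[of "of_real R"] R norm_ge_zero[of "g (of_real R)"] by (simp del: norm_ge_zero)
  have "cmod (h z) \<le> M / R"
  proof (rule maximum_modulus_frontier[of h "cball 0 R"])
    show "h holomorphic_on interior (cball 0 R)"
      by (rule holomorphic_on_subset[OF h(1)]) auto
    show "continuous_on (closure (cball 0 R)) h"
      by (rule holomorphic_on_imp_continuous_on, rule holomorphic_on_subset[OF h(1)]) auto
    show "cmod (h y) \<le> M / R" if "y \<in> frontier (cball 0 R)" for y
    proof -
      have "cmod y = R" using that R by (simp add: frontier_cball)
      with M[of y] h(2)[of y] R show ?thesis by (simp add: norm_mult pos_le_divide_eq mult.commute)
    qed
  qed (use z r in auto)
  hence "R * cmod (h z) \<le> M" using R by (simp add: pos_le_divide_eq mult.commute)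
  hence "cmod z * (R * cmod (h z)) \<le> r * M" using z M0 r R by (intro mult_mono) auto
  thus ?thesis using h(2)[of z] z r by (simp add: norm_mult mult_ac)
qed

text \<open>
  Normalise \<open>g\<close> to vanish at \<open>0\<close> and let \<open>M r\<close> be its maximum on the disc of radius \<open>r\<close>. If \<open>L\<close> covers the
  circle of radius \<open>R \<ge> K r\<close> from that disc, then \<open>M R \<le> |a| M r + const\<close>, whereas \<open>M R \<ge> K M r\<close> by
  Schwarz's lemma. For \<open>K > |a|\<close> this bounds \<open>M r\<close> along arbitrarily large \<open>r\<close>.
\<close>
lemma affine_if_semiconjugate_to_affine:
  fixes a b :: complex
  assumes L: "L holomorphic_on UNIV" and g: "g holomorphic_on UNIV" "\<not> g constant_on UNIV"
    and eq: "\<And>z. g (L z) = a * g z + b"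
  shows "\<exists>q c. \<forall>z. L z = q * z + c"
proof (rule ccontr)
  assume na: "\<nexists>q c. \<forall>z. L z = q * z + c"
  define G where "G = (\<lambda>z. g z - g 0)"
  have G: "G holomorphic_on UNIV" "G 0 = 0" unfolding G_def using g by (auto intro!: holomorphic_intros)
  define b' where "b' = a * g 0 + b - g 0"
  have eqG: "G (L z) = a * G z + b'" for z by (simp add: G_def eq b'_def algebra_simps)
  (* Any K >= 1 above |a| would do; this one gives the bound |b'|. *)
  define K where "K = 2 * cmod a + 1"
  have K: "K \<ge> 1" by (simp add: K_def)
  have bnd: "cmod (G z) \<le> cmod b'" for z
  proof -
    obtain r R where r: "r \<ge> cmod z" "r > 0" "R \<ge> K * r" "sphere 0 R \<subseteq> L ` cball 0 r"
      using entire_covers_large_sphere[OF L na, of K "cmod z"] K by auto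
    have "r \<le> K * r" using K r by simp
    hence "r \<le> R" using r by linarith
    have "continuous_on (cball 0 r) (\<lambda>z. cmod (G z))"
      using G by (intro continuous_intros holomorphic_on_imp_continuous_on holomorphic_on_subset[OF G(1)]) auto
    then obtain zm where zm: "zm \<in> cball 0 r" "\<And>y. y \<in> cball 0 r \<Longrightarrow> cmod (G y) \<le> cmod (G zm)"
      using continuous_attains_sup[of "cball 0 r" "\<lambda>z. cmod (G z)"] r by auto
    define M where "M = cmod (G zm)"
    have "cmod (G w) \<le> cmod a * M + cmod b'" if w: "cmod w = R" for w
    proof -
      obtain y where y: "y \<in> cball 0 r" "w = L y" using w subsetD[OF r(4), of w] by auto
      have "cmod (G w) \<le> cmod (a * G y) + cmod b'" unfolding y eqG by (rule norm_triangle_ineq)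
      also have "cmod (a * G y) \<le> cmod a * M"
        unfolding norm_mult M_def using zm y by (intro mult_left_mono) auto
      finally show ?thesis by simp
    qed
    hence "R * cmod (G zm) \<le> r * (cmod a * M + cmod b')"
      using zm by (intro maximum_modulus_scaling[OF G \<open>r > 0\<close> \<open>r \<le> R\<close>]) auto
    moreover have "K * r * M \<le> R * M" using r by (intro mult_right_mono) (auto simp: M_def)
    ultimately have "r * (K * M) \<le> r * (cmod a * M + cmod b')" by (simp add: M_def mult_ac)
    hence "K * M \<le> cmod a * M + cmod b'" using r by simp
    moreover have "cmod a * M \<ge> 0" by (simp add: M_def)
    ultimately have "M \<le> cmod b'" by (simp add: K_def algebra_simps)
    thus ?thesis using zm(2)[of z] r by (simp add: M_def)
  qed
  hence "bounded (range G)" by (auto simp: bounded_iff)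
  hence "G constant_on UNIV" using Liouville_theorem[OF G(1)] by (auto simp: constant_on_def)
  hence "g constant_on UNIV" unfolding constant_on_def G_def by (metis diff_add_cancel)
  with g show False by simp
qed

text \<open>
  For \<open>q \<noteq> 1\<close> the affine map has a fixed point \<open>p\<close>; evaluating there gives \<open>b = 0\<close>. Hence \<open>g\<close> is
  invariant under the homothety with centre \<open>p\<close> and factor \<open>q\<close>, and its iterates, or those of its
  inverse, contract every point to \<open>p\<close> unless \<open>|q| = 1\<close>.
\<close>
lemma affine_translation_symmetry_multiplier:
  assumes g: "g holomorphic_on UNIV" "\<not> g constant_on UNIV"
    and q: "q \<noteq> 0"
    and eq: "\<And>z. g (q * z + c) = g z + b"
  shows "cmod q = 1"
proof (cases "q = 1")
  case False
  define p where "p = c / (1 - q)"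
  have p: "q * p + c = p" using False by (simp add: p_def field_simps)
  have b: "b = 0" using eq[of p] p by simp
  have it: "g (p + q * u) = g (p + u)" for u
  proof -
    have "q * (p + u) + c = p + q * u" using p by (simp add: algebra_simps)
    thus ?thesis using eq[of "p + u"] b by simp
  qed
  have const: "g constant_on UNIV" if t: "cmod t < 1" "\<And>u. g (p + t * u) = g (p + u)" for t
  proof -
    have "g (p + u) = g p" for u
    proof -
      have "g (p + t ^ j * u) = g (p + u)" for j
      proof (induction j)
        case (Suc j)
        have "g (p + t ^ Suc j * u) = g (p + t * (t ^ j * u))" by (simp add: mult_ac)
        with Suc t(2) show ?case by simp
      qed simp
      moreover have "(\<lambda>j. p + t ^ j * u) \<longlonglongrightarrow> p + 0 * u"
        by (intro tendsto_intros LIMSEQ_power_zero t(1))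
      hence "(\<lambda>j. g (p + t ^ j * u)) \<longlonglongrightarrow> g p"
        using continuous_on_tendsto_compose[OF holomorphic_on_imp_continuous_on[OF g(1)]] by simp
      ultimately show ?thesis by (simp add: LIMSEQ_const_iff)
    qed
    thus ?thesis unfolding constant_on_def by (metis add.commute diff_add_cancel)
  qed
  have "\<not> cmod q < 1" using const[of q] it g by blast
  moreover have "\<not> cmod (1 / q) < 1"
  proof
    assume "cmod (1 / q) < 1"
    moreover have "g (p + 1 / q * u) = g (p + u)" for u using it[of "1/q * u"] q by simp
    ultimately show False using const g by blast
  qed
  ultimately show ?thesis using q by (simp add: norm_divide)
qed auto

section \<open>Solutions of the functional equation\<close>

text \<open>
  The points excluded in the equation form a sparse set: the poles of \<open>f\<close> are isolated, and so are their
  preimages because \<open>L\<close> is not constant.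
\<close>
lemma solution_equation_cosparse:
  assumes f: "f nicely_meromorphic_on UNIV" and L: "L holomorphic_on UNIV" "\<not> L constant_on UNIV"
    and sol: "solves_fermat_eq n m L g f"
  shows "\<forall>\<^sub>\<approx>z. f z ^ n + f (L z) ^ m = exp (g z)"
proof -
  have mero: "f meromorphic_on UNIV" using f by (simp add: nicely_meromorphic_on_def)
  have np: "\<forall>\<^sub>\<approx>z. \<not> is_pole f z" by (rule meromorphic_on_imp_not_pole_cosparse[OF mero])
  have "\<forall>\<^sub>F w in at z. \<not> is_pole f (L w)" for z
  proof -
    have "L \<midarrow>z\<rightarrow> L z"
      using holomorphic_on_imp_continuous_on[OF L(1)] by (auto simp: continuous_on_def)
    hence "filterlim L (at (L z)) (at z)"
      using entire_eventually_neq_value[OF L] by (simp add: filterlim_at)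
    thus ?thesis
      using eventually_cosparse_imp_eventually_at[OF np, of "L z" UNIV]
      by (auto simp: filterlim_iff)
  qed
  hence "\<forall>\<^sub>\<approx>z. \<not> is_pole f (L z)" by (simp add: eventually_cosparse_open_eq)
  with np show ?thesis
    by eventually_elim (use sol in \<open>auto simp: solves_fermat_eq_def\<close>)
qed

lemma nicely_meromorphic_eq_entire:
  assumes f: "f nicely_meromorphic_on UNIV" and P: "P holomorphic_on UNIV" and ev: "\<forall>\<^sub>\<approx>z. f z = P z"
  shows "f z = P z"
proof -
  have "f holomorphic_on UNIV" by (rule entire_if_power_eq_entire[OF f P, of 1]) (use ev in auto)
  from entire_eq_if_eventually_eq[OF this P ev] show ?thesis .
qed

text \<open>
  The curve theorem asks for the larger exponent first; for \<open>m > n \<ge> 3\<close> it is applied with \<open>F\<close> and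
  \<open>G\<close> exchanged.
\<close>
lemma solution_is_exponential:
  assumes L: "L holomorphic_on UNIV" "\<not> L constant_on UNIV" and g: "g holomorphic_on UNIV"
    and f: "f nicely_meromorphic_on UNIV"
    and nm: "n \<ge> 2" "m \<ge> 3" "(n, m) \<noteq> (3, 3)"
    and sol: "solves_fermat_eq n m L g f"
  obtains A where "\<And>z. f z = A * exp (g z / of_nat n)"
proof -
  note ev = solution_equation_cosparse[OF f L sol]
  have n0: "n \<noteq> 0" and m0: "m \<noteq> 0" using nm by auto
  have mero: "f meromorphic_on UNIV" using f by (simp add: nicely_meromorphic_on_def)
  define F where "F = (\<lambda>z. f z * exp (- g z / of_nat n))"
  define G where "G = (\<lambda>z. f (L z) * exp (- g z / of_nat m))"
  have FG: "F z ^ n + G z ^ m = 1" if "f z ^ n + f (L z) ^ m = exp (g z)" for z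
  proof -
    have "exp (- g z / of_nat k) ^ k = exp (- g z)" if "k \<noteq> 0" for k
      using that by (simp flip: exp_of_nat_mult)
    hence "F z ^ n + G z ^ m = (f z ^ n + f (L z) ^ m) * exp (- g z)"
      using n0 m0 by (simp add: F_def G_def power_mult_distrib distrib_right)
    thus ?thesis using that by (simp flip: exp_add)
  qed
  have expm: "(\<lambda>z. exp (- g z / of_nat k)) meromorphic_on UNIV" for k
    using g by (intro analytic_on_imp_meromorphic_on) (cases "k = 0", auto simp: analytic_on_open intro!: holomorphic_intros)
  have "\<exists>A. \<forall>\<^sub>\<approx>z. F z = A"
  proof (cases "n = 2")
    case True
    have np: "\<not> is_pole f z" for z
      by (rule no_poles_if_exponent_smaller[OF f L g _ _ ev]) (use True nm in auto)
    have "f analytic_on {z}" for z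
      by (rule nicely_meromorphic_on_imp_analytic_at[OF f _ np]) auto
    hence hf: "f holomorphic_on UNIV" using analytic_on_analytic_at analytic_imp_holomorphic by blast
    have "(\<lambda>z. f (L z)) holomorphic_on UNIV"
      using holomorphic_on_compose_gen[OF L(1) hf] by (simp add: o_def)
    hence "F holomorphic_on UNIV" "G holomorphic_on UNIV"
      unfolding F_def G_def using hf g n0 m0 by (auto intro!: holomorphic_intros)
    moreover have "F z ^ 2 + G z ^ m = 1" for z
      using FG[of z] sol np True by (auto simp: solves_fermat_eq_def)
    ultimately obtain A where "\<And>z. F z = A" using fermat_2_entire_constant[of F G m] nm by blast
    thus ?thesis by auto
  next
    case False
    have mF: "F meromorphic_on UNIV" unfolding F_def by (intro meromorphic_intros mero expm)
    have "(\<lambda>z. f (L z)) meromorphic_on UNIV"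
      by (rule meromorphic_on_compose[OF mero]) (use L in \<open>auto simp: analytic_on_open\<close>)
    hence mG: "G meromorphic_on UNIV" unfolding G_def by (intro meromorphic_intros expm)
    note nF = remove_sings_nicely_meromorphic[OF mF] and nG = remove_sings_nicely_meromorphic[OF mG]
    note evF = eventually_remove_sings_eq[OF mF] and evG = eventually_remove_sings_eq[OF mG]
    have e1: "\<forall>\<^sub>\<approx>z. remove_sings F z ^ n + remove_sings G z ^ m = 1"
      using ev evF evG by eventually_elim (use FG in auto)
    have e2: "\<forall>\<^sub>\<approx>z. remove_sings G z ^ m + remove_sings F z ^ n = 1"
      using e1 by eventually_elim (simp add: add.commute)
    have "\<exists>A. \<forall>z. remove_sings F z = A"
    proof (cases "m \<le> n")
      case True
      with fermat_meromorphic_constant[OF nF nG _ _ _ e1] False nm show ?thesis by fastforce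
    next
      case False
      with fermat_meromorphic_constant[OF nG nF _ _ _ e2] \<open>n \<noteq> 2\<close> nm show ?thesis by fastforce
    qed
    then obtain A where "\<And>z. remove_sings F z = A" by blast
    with evF have "\<forall>\<^sub>\<approx>z. F z = A" by (auto elim: eventually_mono)
    thus ?thesis by blast
  qed
  then obtain A where A: "\<forall>\<^sub>\<approx>z. F z = A" by blast
  have "\<forall>\<^sub>\<approx>z. f z = A * exp (g z / of_nat n)"
    using A
  proof eventually_elim
    case (elim z)
    have "f z = F z * exp (g z / of_nat n)" unfolding F_def by (simp add: mult.assoc flip: exp_add)
    with elim show ?case by simp
  qed
  moreover have "(\<lambda>z. A * exp (g z / of_nat n)) holomorphic_on UNIV"
    using g n0 by (auto intro!: holomorphic_intros)
  ultimately show ?thesis using nicely_meromorphic_eq_entire[OF f] that by blast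
qed

lemma constant_if_exp_constant:
  assumes u: "u holomorphic_on UNIV" and c: "\<And>z. exp (u z) = (c :: complex)"
  shows "u z = u w"
proof -
  have "(u has_field_derivative 0) (at z)" for z
  proof -
    have d: "(u has_field_derivative deriv u z) (at z)" using u by (auto intro: holomorphic_derivI)
    hence "((\<lambda>z. exp (u z)) has_field_derivative exp (u z) * deriv u z) (at z)"
      by (auto intro!: derivative_eq_intros)
    moreover have "((\<lambda>z. exp (u z)) has_field_derivative 0) (at z)" unfolding c by simp
    ultimately have "exp (u z) * deriv u z = 0" by (rule DERIV_unique)
    with d show ?thesis by simp
  qed
  hence "\<exists>c. \<forall>z\<in>UNIV. u z = c"
    by (intro has_field_derivative_zero_constant) auto
  thus ?thesis by auto
qed

text \<open>
  With \<open>u = g \<circ> L / n - g / m\<close> the equation reads \<open>A ^ n + (A exp u) ^ m = 1\<close>, so \<open>u\<close> is a constant \<open>l\<close>.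
\<close>
lemma solution_functional_equation:
  assumes L: "L holomorphic_on UNIV" and g: "g holomorphic_on UNIV"
    and f: "\<not> f constant_on UNIV" "\<And>z. f z = A * exp (g z / of_nat n)"
    and nm: "n > 0" "m > 0"
    and sol: "solves_fermat_eq n m L g f"
  obtains B l where "A \<noteq> 0" "B \<noteq> 0" "A ^ n + B ^ m = 1" "exp l = B / A"
    "\<And>z. g (L z) = of_nat n / of_nat m * g z + of_nat n * l"
proof -
  have n0: "n \<noteq> 0" and m0: "m \<noteq> 0" using nm by auto
  have A0: "A \<noteq> 0" using f unfolding constant_on_def by auto
  have gL: "(\<lambda>z. g (L z)) holomorphic_on UNIV"
    using holomorphic_on_compose_gen[OF L g] by (simp add: o_def)
  have hf: "f holomorphic_on UNIV"
    using g n0 unfolding f(2)[abs_def] by (auto intro!: holomorphic_intros)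
  have np: "\<not> is_pole f z" for z using not_is_pole_holomorphic[OF open_UNIV _ hf] by auto
  have eq: "f z ^ n + f (L z) ^ m = exp (g z)" for z using sol np by (auto simp: solves_fermat_eq_def)
  define u where "u = (\<lambda>z. g (L z) / of_nat n - g z / of_nat m)"
  have u: "u holomorphic_on UNIV" unfolding u_def using gL g n0 m0 by (auto intro!: holomorphic_intros)
  have key: "A ^ n + (A * exp (u z)) ^ m = 1" for z
  proof -
    have "f (L z) = A * exp (u z) * exp (g z / of_nat m)"
      by (simp add: f(2) u_def mult.assoc flip: exp_add)
    moreover have "exp (g z / of_nat k) ^ k = exp (g z)" if "k \<noteq> 0" for k
      using that by (simp flip: exp_of_nat_mult)
    ultimately have "(A ^ n + (A * exp (u z)) ^ m) * exp (g z) = 1 * exp (g z)"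
      using eq[of z] n0 m0 by (simp add: f(2)[of z] power_mult_distrib distrib_right)
    thus ?thesis by (simp only: mult_right_cancel[OF exp_not_eq_zero])
  qed
  have hE: "(\<lambda>z. A * exp (u z)) holomorphic_on UNIV" using u by (auto intro!: holomorphic_intros)
  obtain B where B: "\<And>z. A * exp (u z) = B"
  proof (rule constant_if_power_constant[where F = "\<lambda>z. A * exp (u z)" and n = m and c = "1 - A ^ n"])
    show "(\<lambda>z. A * exp (u z)) nicely_meromorphic_on UNIV"
      using hE by (intro analytic_on_imp_nicely_meromorphic_on) (simp add: analytic_on_open)
    show "\<forall>\<^sub>\<approx>z. (A * exp (u z)) ^ m = 1 - A ^ n" using key by (simp add: algebra_simps)
  qed (use nm that in auto)
  have expu: "exp (u z) = B / A" for z using B[of z] A0 by (simp add: field_simps)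
  show ?thesis
  proof (rule that[of B "u 0"])
    show "B \<noteq> 0" using B[of 0] A0 by auto
    show "A ^ n + B ^ m = 1" using key[of 0] B by simp
    show "exp (u 0) = B / A" by (rule expu)
    show "g (L z) = of_nat n / of_nat m * g z + of_nat n * u 0" for z
    proof -
      have "u 0 = u z" by (rule constant_if_exp_constant[OF u expu])
      moreover have "g (L z) = of_nat n / of_nat m * g z + of_nat n * u z"
        using n0 m0 by (simp add: u_def field_simps)
      ultimately show ?thesis by simp
    qed
  qed (rule A0)
qed

theorem proposition2:
  fixes L g f :: "complex \<Rightarrow> complex" and n m :: nat
  assumes "L holomorphic_on UNIV" and "\<not> L constant_on UNIV"
    and "g holomorphic_on UNIV"
    and "f nicely_meromorphic_on UNIV" and "\<not> f constant_on UNIV"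
    and "n \<ge> 2" and "m \<ge> 3" and "(n, m) \<noteq> (3, 3)"
  shows "(solves_fermat_eq n m L g f \<longleftrightarrow>
           (\<exists>q c A B l :: complex.
              (\<forall>z. L z = q * z + c) \<and>
              A \<noteq> 0 \<and> B \<noteq> 0 \<and> A ^ n + B ^ m = 1 \<and>
              (\<forall>z. f z = A * exp (g z / of_nat n)) \<and>
              exp l = B / A \<and>
              (\<forall>z. g (L z) = of_nat n / of_nat m * g z + of_nat n * l)))
       \<and> (m = n \<longrightarrow> solves_fermat_eq n m L g f \<longrightarrow>
           (\<forall>q c :: complex. (\<forall>z. L z = q * z + c) \<longrightarrow> norm q = 1))"
proof -
  have n0: "n > 0" and m0: "m > 0" using assms by auto
  have only_if: "\<exists>q c A B l. (\<forall>z. L z = q * z + c) \<and>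
              A \<noteq> 0 \<and> B \<noteq> 0 \<and> A ^ n + B ^ m = 1 \<and>
              (\<forall>z. f z = A * exp (g z / of_nat n)) \<and> exp l = B / A \<and>
              (\<forall>z. g (L z) = of_nat n / of_nat m * g z + of_nat n * l)"
    and g_nonconst: "\<not> g constant_on UNIV"
    if sol: "solves_fermat_eq n m L g f"
  proof -
    obtain A where A: "\<And>z. f z = A * exp (g z / of_nat n)"
      using solution_is_exponential[OF assms(1-4,6-8) sol] by blast
    obtain B l where Bl: "A \<noteq> 0" "B \<noteq> 0" "A ^ n + B ^ m = 1" "exp l = B / A"
      "\<And>z. g (L z) = of_nat n / of_nat m * g z + of_nat n * l"
      using solution_functional_equation[OF assms(1,3,5) A n0 m0 sol] by blast
    show nc: "\<not> g constant_on UNIV"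
    proof
      assume "g constant_on UNIV"
      hence "f constant_on UNIV" unfolding constant_on_def A by auto
      with assms(5) show False by simp
    qed
    obtain q c where "\<forall>z. L z = q * z + c"
      using affine_if_semiconjugate_to_affine[OF assms(1,3) nc Bl(5)] by blast
    with A Bl show "\<exists>q c A B l. (\<forall>z. L z = q * z + c) \<and>
              A \<noteq> 0 \<and> B \<noteq> 0 \<and> A ^ n + B ^ m = 1 \<and>
              (\<forall>z. f z = A * exp (g z / of_nat n)) \<and> exp l = B / A \<and>
              (\<forall>z. g (L z) = of_nat n / of_nat m * g z + of_nat n * l)"
      by blast
  qed
  have conv: "solves_fermat_eq n m L g f"
    if AB: "A \<noteq> 0" "A ^ n + B ^ m = 1" "exp l = B / A"
      and f: "\<And>z. f z = A * exp (g z / of_nat n)"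
      and g: "\<And>z. g (L z) = of_nat n / of_nat m * g z + of_nat n * l" for A B l
    unfolding solves_fermat_eq_def
  proof (intro allI impI)
    fix z
    have pw: "exp (g z / of_nat k) ^ k = exp (g z)" if "k > 0" for k
      using that by (simp flip: exp_of_nat_mult)
    have "g (L z) / of_nat n = g z / of_nat m + l" using n0 by (simp add: g field_simps)
    hence "f (L z) = B * exp (g z / of_nat m)" using AB by (simp add: f exp_add)
    hence "f z ^ n + f (L z) ^ m = (A ^ n + B ^ m) * exp (g z)"
      using pw[OF n0] pw[OF m0] by (simp add: f[of z] power_mult_distrib distrib_right)
    thus "f z ^ n + f (L z) ^ m = exp (g z)" using AB by simp
  qed
  have "norm q = 1" if mn: "m = n" and sol: "solves_fermat_eq n m L g f" and Lq: "\<forall>z. L z = q * z + c" for q c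
  proof -
    obtain l where "\<And>z. g (L z) = of_nat n / of_nat m * g z + of_nat n * l"
      using only_if[OF sol] by blast
    hence "g (q * z + c) = g z + of_nat n * l" for z using Lq mn n0 by simp
    moreover have "q \<noteq> 0" using assms(2) Lq unfolding constant_on_def by auto
    ultimately show ?thesis
      by (intro affine_translation_symmetry_multiplier[OF assms(3) g_nonconst[OF sol]])
  qed
  with only_if conv show ?thesis by blast
qed

end
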